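(* For every $L\in\mathbf L^{\rm reg}$ and $V\in\mathcal V(L)$ there is $r_0>0$ such that, for all $r\in[0,r_0]$, $$\exp_{[L]}\big(\iota_L^{-1}(rV)\big)=[L+rV].$$
   Context: Fix integers $d,T\ge 1$. Write matrices $A\in\mathbb R^{dT\times dT}$ in block form $A=(A_{s,t})_{s,t=1}^T$ with $A_{s,t}\in\mathbb R^{d\times d}$; $(AB)_{t,t}$ is the $t$-th diagonal block of $AB$. $\mathbf L$ is the set of block-lower-triangular matrices ($L_{t,s}=0$ for $s>t$). $\mathbf O=\{\mathrm{diag}(O_1,\dots,O_T): O_t\in\mathbb R^{d\times d}\text{ orthogonal}\}$. $\|\cdot\|_{\rm F}$ is the Frobenius norm. For $L,M\in\mathbf L$, $d_{\rm ABW}(L,M)=\min_{O\in\mathbf O}\|L-MO\|_{\rm F}$ (equal to the adapted Wasserstein distance between the Gaussian processes $LG$ and $MG$), and $\mathbf O^*(L,M)=\{P\in\mathbf O:\|L-MP\|_{\rm F}=d_{\rm ABW}(L,M)\}$. $\mathbf L/_{\mathbf O}$ is the quotient by $L\sim M\iff L=MO$ for some $O\in\mathbf O$, with classes $[L]$ and the induced metric $d_{\rm ABW}$. $\mathbf L^{\rm reg}=\{L\in\mathbf L:(L^\top L)_{t,t}\text{ is positive definite for all }t\}$. $\mathcal V(L)=\{V\in\mathbf L:(V^\top L)_{t,t}\text{ is symmetric for all }t\}$. $\mathbf V(L)=\{MP-L:M\in\mathbf L,\ P\in\mathbf O^*(L,M)\}$. Tangent cone: $\Gamma([L])$ is the set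 of curves $\gamma:[0,1]\to\mathbf L/_{\mathbf O}$ with $\gamma(0)=[L]$ and $d_{\rm ABW}(\gamma(u),\gamma(v))=|u-v|d_{\rm ABW}(\gamma(0),\gamma(1))$ for all $u,v$ (constant speed geodesics); $0\in\Gamma([L])$ is the constant one. For $\gamma,\eta\in\Gamma([L])\setminus\{0\}$ the angle $\angle(\gamma,\eta)\in[0,\pi]$ is defined by $$\cos\angle(\gamma,\eta)=\lim_{u\downarrow0}\frac{d_{\rm ABW}^2([L],\gamma(u))+d_{\rm ABW}^2([L],\eta(u))-d_{\rm ABW}^2(\gamma(u),\eta(u))}{2d_{\rm ABW}([L],\gamma(u))\,d_{\rm ABW}([L],\eta(u))}.$$ $\overline\Gamma([L])$ is the completion of $(\Gamma([L])\setminus\{0\})/_{\angle}$ with respect to $\angle$, and $\mathbf T([L])$ is $\overline\Gamma([L])\times[0,\infty)$ with all points $(\gamma,0)$ identified (the tip), with metric $d_{\mathbf T([L])}^2((\gamma,r),(\eta,s))=r^2+s^2-2rs\cos\angle(\gamma,\eta)$. For $L\in\mathbf L^{\rm reg}$, $\iota_L:(\mathbf T([L]),d_{\mathbf T([L])})\to(\mathcal V(L),\|\cdot\|_{\rm F})$ is the isometry (distance-preserving bijection) that sends the tip to $0$ and sends $([\gamma]_\angle,r)$ to $rV/\|V\|_{\rm F}$, where $V\in\mathbf V(L)\setminus\{0\}$ is the unique element with $\gamma(u)=[L+uV]$ for all $u\in[0,1]$. Exponential map: $\exp_{[L]}$ sends the tip to $[L]$ and sends $([\gamma]_\angle,r)$,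 $r>0$, to $\eta(1)$, where $\eta\in\Gamma([L])\setminus\{0\}$ satisfies $\angle(\gamma,\eta)=0$ and $d_{\rm ABW}([L],\eta(1))=r$, if such $\eta$ exists (otherwise $\exp_{[L]}$ is undefined at that vector). The claim includes that $\exp_{[L]}$ is defined at the vectors in question. *)

theory Defs
  imports "HOL-Analysis.Analysis"
begin

section \<open>Block matrices\<close>

text \<open>
  A real \<open>dT \<times> dT\<close> matrix in block form is a matrix indexed by pairs (block index, index inside
  the block). Here \<open>T = CARD('t)\<close>, the linear order of \<open>'t\<close> being that of \<open>1, \<dots>, T\<close>, and
  \<open>d = CARD('d)\<close>. The standard norm on this type is the Frobenius norm.
\<close>

type_synonym ('t, 'd) bmat = "real ^ ('t \<times> 'd) ^ ('t \<times> 'd)"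

definition block :: "('t::finite, 'd::finite) bmat \<Rightarrow> 't \<Rightarrow> 't \<Rightarrow> real ^ 'd ^ 'd" where
  "block A s t = (\<chi> i j. A $ (s, i) $ (t, j))"

definition block_diag :: "('t::finite \<Rightarrow> real ^ 'd ^ 'd) \<Rightarrow> ('t, 'd::finite) bmat" where
  "block_diag D = (\<chi> p q. if fst p = fst q then D (fst p) $ snd p $ snd q else 0)"

definition symmetric_matrix :: "real ^ 'n ^ 'n \<Rightarrow> bool" where
  "symmetric_matrix A \<longleftrightarrow> transpose A = A"

definition positive_definite :: "real ^ 'n ^ 'n \<Rightarrow> bool" where
  "positive_definite A \<longleftrightarrow> symmetric_matrix A \<and> (\<forall>x. x \<noteq> 0 \<longrightarrow> x \<bullet> (A *v x) > 0)"

definition BL :: "('t::{finite,linorder}, 'd::finite) bmat set" where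
  "BL = {L. \<forall>t s. t < s \<longrightarrow> block L t s = 0}"

definition BO :: "('t::finite, 'd::finite) bmat set" where
  "BO = {block_diag D | D. \<forall>t. orthogonal_matrix (D t)}"

definition BL_reg :: "('t::{finite,linorder}, 'd::finite) bmat set" where
  "BL_reg = {L \<in> BL. \<forall>t. positive_definite (block (transpose L ** L) t t)}"


section \<open>The adapted Bures--Wasserstein distance\<close>

text \<open>The infimum is a minimum, see \<open>d_ABW_attained\<close> below.\<close>

definition d_ABW :: "('t::finite, 'd::finite) bmat \<Rightarrow> ('t, 'd) bmat \<Rightarrow> real" where
  "d_ABW L M = (INF P\<in>BO. norm (L - M ** P))"

definition opt_BO :: "('t::finite, 'd::finite) bmat \<Rightarrow> ('t, 'd) bmat \<Rightarrow> ('t, 'd) bmat set" where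
  "opt_BO L M = {P \<in> BO. norm (L - M ** P) = d_ABW L M}"

definition calV :: "('t::{finite,linorder}, 'd::finite) bmat \<Rightarrow> ('t, 'd) bmat set" where
  "calV L = {V \<in> BL. \<forall>t. symmetric_matrix (block (transpose V ** L) t t)}"

definition bfV :: "('t::{finite,linorder}, 'd::finite) bmat \<Rightarrow> ('t, 'd) bmat set" where
  "bfV L = {M ** P - L | M P. M \<in> BL \<and> P \<in> opt_BO L M}"


section \<open>The quotient by block-orthogonal matrices\<close>

text \<open>The value of a two-argument function on classes, computed on arbitrary representatives.\<close>

definition lift2 :: "('a \<Rightarrow> 'b \<Rightarrow> 'c) \<Rightarrow> 'a set \<Rightarrow> 'b set \<Rightarrow> 'c" where
  "lift2 f X Y = the_elem {f x y | x y. x \<in> X \<and> y \<in> Y}"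

definition BO_rel :: "(('t::{finite,linorder}, 'd::finite) bmat \<times> ('t, 'd) bmat) set" where
  "BO_rel = {(L, M). L \<in> BL \<and> M \<in> BL \<and> (\<exists>P\<in>BO. L = M ** P)}"

definition BL_quot :: "('t::{finite,linorder}, 'd::finite) bmat set set" where
  "BL_quot = BL // BO_rel"

definition cls :: "('t::{finite,linorder}, 'd::finite) bmat \<Rightarrow> ('t, 'd) bmat set" where
  "cls L = BO_rel `` {L}"

definition dq :: "('t::{finite,linorder}, 'd::finite) bmat set \<Rightarrow> ('t, 'd) bmat set \<Rightarrow> real" where
  "dq = lift2 d_ABW"


section \<open>Geodesics and angles\<close>

text \<open>Curves on \<open>[0,1]\<close> are extensional functions, i.e. they carry no information outside \<open>[0,1]\<close>.\<close>

type_synonym ('t, 'd) curve = "real \<Rightarrow> ('t, 'd) bmat set"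

definition Geod :: "('t::{finite,linorder}, 'd::finite) bmat set \<Rightarrow> ('t, 'd) curve set" where
  "Geod X = {\<gamma> \<in> {0..1} \<rightarrow>\<^sub>E BL_quot. \<gamma> 0 = X \<and>
     (\<forall>u\<in>{0..1}. \<forall>v\<in>{0..1}. dq (\<gamma> u) (\<gamma> v) = \<bar>u - v\<bar> * dq (\<gamma> 0) (\<gamma> 1))}"

definition const_geod :: "('t::{finite,linorder}, 'd::finite) bmat set \<Rightarrow> ('t, 'd) curve" where
  "const_geod X = (\<lambda>u\<in>{0..1}. X)"

definition Geod0 :: "('t::{finite,linorder}, 'd::finite) bmat set \<Rightarrow> ('t, 'd) curve set" where
  "Geod0 X = Geod X - {const_geod X}"

definition angle ::
    "('t::{finite,linorder}, 'd::finite) bmat set \<Rightarrow> ('t, 'd) curve \<Rightarrow> ('t, 'd) curve \<Rightarrow> real" where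
  "angle X \<gamma> \<eta> = (THE a. 0 \<le> a \<and> a \<le> pi \<and>
     ((\<lambda>u. ((dq X (\<gamma> u))\<^sup>2 + (dq X (\<eta> u))\<^sup>2 - (dq (\<gamma> u) (\<eta> u))\<^sup>2)
             / (2 * dq X (\<gamma> u) * dq X (\<eta> u))) \<longlongrightarrow> cos a) (at_right 0))"


section \<open>The tangent cone\<close>

definition angle_rel ::
    "('t::{finite,linorder}, 'd::finite) bmat set \<Rightarrow> (('t, 'd) curve \<times> ('t, 'd) curve) set" where
  "angle_rel X = {(\<gamma>, \<eta>). \<gamma> \<in> Geod0 X \<and> \<eta> \<in> Geod0 X \<and> angle X \<gamma> \<eta> = 0}"

definition Dirs :: "('t::{finite,linorder}, 'd::finite) bmat set \<Rightarrow> ('t, 'd) curve set set" where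
  "Dirs X = Geod0 X // angle_rel X"

text \<open>The completion of a set \<open>S\<close> with respect to a distance \<open>\<delta>\<close>: Cauchy sequences in \<open>S\<close>, two of
  them being identified if their distance tends to \<open>0\<close>; \<open>S\<close> embeds through constant sequences.\<close>

definition cauchy_seqs :: "'a set \<Rightarrow> ('a \<Rightarrow> 'a \<Rightarrow> real) \<Rightarrow> (nat \<Rightarrow> 'a) set" where
  "cauchy_seqs S \<delta> = {x. range x \<subseteq> S \<and> (\<forall>e>0. \<exists>N. \<forall>m\<ge>N. \<forall>n\<ge>N. \<delta> (x m) (x n) < e)}"

definition cauchy_rel :: "'a set \<Rightarrow> ('a \<Rightarrow> 'a \<Rightarrow> real) \<Rightarrow> ((nat \<Rightarrow> 'a) \<times> (nat \<Rightarrow> 'a)) set" where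
  "cauchy_rel S \<delta> = {(x, y). x \<in> cauchy_seqs S \<delta> \<and> y \<in> cauchy_seqs S \<delta> \<and>
     (\<lambda>n. \<delta> (x n) (y n)) \<longlonglongrightarrow> 0}"

definition completion :: "'a set \<Rightarrow> ('a \<Rightarrow> 'a \<Rightarrow> real) \<Rightarrow> (nat \<Rightarrow> 'a) set set" where
  "completion S \<delta> = cauchy_seqs S \<delta> // cauchy_rel S \<delta>"

definition completion_dist ::
    "('a \<Rightarrow> 'a \<Rightarrow> real) \<Rightarrow> (nat \<Rightarrow> 'a) set \<Rightarrow> (nat \<Rightarrow> 'a) set \<Rightarrow> real" where
  "completion_dist \<delta> = lift2 (\<lambda>x y. lim (\<lambda>n. \<delta> (x n) (y n)))"

definition completion_embed :: "'a set \<Rightarrow> ('a \<Rightarrow> 'a \<Rightarrow> real) \<Rightarrow> 'a \<Rightarrow> (nat \<Rightarrow> 'a) set" where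
  "completion_embed S \<delta> a = cauchy_rel S \<delta> `` {\<lambda>n. a}"

type_synonym ('t, 'd) dir = "(nat \<Rightarrow> ('t, 'd) curve set) set"

definition CDirs :: "('t::{finite,linorder}, 'd::finite) bmat set \<Rightarrow> ('t, 'd) dir set" where
  "CDirs X = completion (Dirs X) (lift2 (angle X))"

definition CDirs_angle ::
    "('t::{finite,linorder}, 'd::finite) bmat set \<Rightarrow> ('t, 'd) dir \<Rightarrow> ('t, 'd) dir \<Rightarrow> real" where
  "CDirs_angle X = completion_dist (lift2 (angle X))"

definition dir_of ::
    "('t::{finite,linorder}, 'd::finite) bmat set \<Rightarrow> ('t, 'd) curve \<Rightarrow> ('t, 'd) dir" where
  "dir_of X \<gamma> = completion_embed (Dirs X) (lift2 (angle X)) (angle_rel X `` {\<gamma>})"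

type_synonym ('t, 'd) tangent = "(('t, 'd) dir \<times> real) set"

definition cone_rel :: "('t::{finite,linorder}, 'd::finite) bmat set \<Rightarrow>
    ((('t, 'd) dir \<times> real) \<times> (('t, 'd) dir \<times> real)) set" where
  "cone_rel X = {(p, q). p \<in> CDirs X \<times> {0..} \<and> q \<in> CDirs X \<times> {0..} \<and>
     (p = q \<or> snd p = 0 \<and> snd q = 0)}"

definition Tcone :: "('t::{finite,linorder}, 'd::finite) bmat set \<Rightarrow> ('t, 'd) tangent set" where
  "Tcone X = (CDirs X \<times> {0..}) // cone_rel X"

definition Ttip :: "('t::{finite,linorder}, 'd::finite) bmat set \<Rightarrow> ('t, 'd) tangent" where
  "Ttip X = CDirs X \<times> {0}"

definition Tvec :: "('t::{finite,linorder}, 'd::finite) bmat set \<Rightarrow> ('t, 'd) curve \<Rightarrow> real \<Rightarrow>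
    ('t, 'd) tangent" where
  "Tvec X \<gamma> r = cone_rel X `` {(dir_of X \<gamma>, r)}"

definition Tdist :: "('t::{finite,linorder}, 'd::finite) bmat set \<Rightarrow>
    ('t, 'd) tangent \<Rightarrow> ('t, 'd) tangent \<Rightarrow> real" where
  "Tdist X = lift2 (\<lambda>(\<xi>, r) (\<zeta>, s). sqrt (r\<^sup>2 + s\<^sup>2 - 2 * r * s * cos (CDirs_angle X \<xi> \<zeta>)))"


section \<open>The isometry with \<open>calV L\<close> and the exponential map\<close>

definition geod_vec ::
    "('t::{finite,linorder}, 'd::finite) bmat \<Rightarrow> ('t, 'd) curve \<Rightarrow> ('t, 'd) bmat" where
  "geod_vec L \<gamma> = (THE V. V \<in> bfV L - {0} \<and> (\<forall>u\<in>{0..1}. \<gamma> u = cls (L + u *\<^sub>R V)))"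

text \<open>The map is extensional on the tangent cone, which makes the definite description meaningful;
  on directions that are only limits of geodesic ones it is determined by being an isometry.\<close>

definition iota ::
    "('t::{finite,linorder}, 'd::finite) bmat \<Rightarrow> ('t, 'd) tangent \<Rightarrow> ('t, 'd) bmat" where
  "iota L = (THE f. f \<in> extensional (Tcone (cls L)) \<and>
     bij_betw f (Tcone (cls L)) (calV L) \<and>
     (\<forall>p\<in>Tcone (cls L). \<forall>q\<in>Tcone (cls L). norm (f p - f q) = Tdist (cls L) p q) \<and>
     f (Ttip (cls L)) = 0 \<and>
     (\<forall>\<gamma>\<in>Geod0 (cls L). \<forall>r\<ge>0.
        f (Tvec (cls L) \<gamma> r) = (r / norm (geod_vec L \<gamma>)) *\<^sub>R geod_vec L \<gamma>))"

text \<open>\<open>exp_reaches X p Y\<close>: the vector \<open>p\<close> is \<open>([\<gamma>], r)\<close> with \<open>r > 0\<close>, and \<open>Y = \<eta>(1)\<close> for a geodesic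
  \<open>\<eta>\<close> of length \<open>r\<close> in the direction of \<open>\<gamma>\<close>.\<close>

definition exp_reaches :: "('t::{finite,linorder}, 'd::finite) bmat set \<Rightarrow>
    ('t, 'd) tangent \<Rightarrow> ('t, 'd) bmat set \<Rightarrow> bool" where
  "exp_reaches X p Y \<longleftrightarrow> (\<exists>\<gamma>\<in>Geod0 X. \<exists>r>0. p = Tvec X \<gamma> r \<and>
     (\<exists>\<eta>\<in>Geod0 X. angle X \<gamma> \<eta> = 0 \<and> dq X (\<eta> 1) = r \<and> Y = \<eta> 1))"

text \<open>The exponential map is partial; \<open>None\<close> means undefined.\<close>

definition exp_map :: "('t::{finite,linorder}, 'd::finite) bmat set \<Rightarrow>
    ('t, 'd) tangent \<Rightarrow> ('t, 'd) bmat set option" where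
  "exp_map X p =
     (if p = Ttip X then Some X
      else if \<exists>Y. exp_reaches X p Y then Some (THE Y. exp_reaches X p Y)
      else None)"


section \<open>Well-definedness\<close>

lemma block_diag_mult: "block_diag D ** block_diag E = block_diag (\<lambda>t. D t ** E t)"
proof -
  have "(\<Sum>k\<in>UNIV. block_diag D $ p $ k * block_diag E $ k $ q)
      = block_diag (\<lambda>t. D t ** E t) $ p $ q" for p q :: "'a \<times> 'b"
  proof -
    have "(\<Sum>k\<in>UNIV. block_diag D $ p $ k * block_diag E $ k $ q)
        = (\<Sum>s\<in>UNIV. \<Sum>j\<in>UNIV. block_diag D $ p $ (s, j) * block_diag E $ (s, j) $ q)"
      by (subst UNIV_Times_UNIV[symmetric], subst sum.cartesian_product) (simp add: case_prod_beta)
    also have "\<dots> = (\<Sum>s\<in>UNIV. if s = fst p then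
        (\<Sum>j\<in>UNIV. block_diag D $ p $ (s, j) * block_diag E $ (s, j) $ q) else 0)"
      by (rule sum.cong) (auto simp: block_diag_def)
    also have "\<dots> = (\<Sum>j\<in>UNIV. block_diag D $ p $ (fst p, j) * block_diag E $ (fst p, j) $ q)"
      by simp
    also have "\<dots> = block_diag (\<lambda>t. D t ** E t) $ p $ q"
      by (simp add: block_diag_def matrix_matrix_mult_def)
    finally show ?thesis .
  qed
  then show ?thesis
    by (simp add: vec_eq_iff matrix_matrix_mult_def)
qed

lemma block_diag_mat1: "block_diag (\<lambda>t. mat 1) = mat 1"
  by (auto simp: block_diag_def mat_def vec_eq_iff prod_eq_iff)

lemma transpose_block_diag: "transpose (block_diag D) = block_diag (\<lambda>t. transpose (D t))"
  by (simp add: block_diag_def transpose_def vec_eq_iff)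

lemma BO_I: "(\<And>t. orthogonal_matrix (D t)) \<Longrightarrow> block_diag D \<in> BO"
  by (auto simp: BO_def)

lemma BO_E:
  assumes "P \<in> BO"
  obtains D where "P = block_diag D" "\<And>t. orthogonal_matrix (D t)"
  using assms by (auto simp: BO_def)

lemma BO_mat1: "mat 1 \<in> BO"
  by (subst block_diag_mat1[symmetric], rule BO_I, rule orthogonal_matrix_id)

lemma BO_mult: "P \<in> BO \<Longrightarrow> Q \<in> BO \<Longrightarrow> P ** Q \<in> BO"
  by (elim BO_E, hypsubst, subst block_diag_mult) (intro BO_I orthogonal_matrix_mul)

lemma BO_transpose: "P \<in> BO \<Longrightarrow> transpose P \<in> BO"
  by (elim BO_E, hypsubst, subst transpose_block_diag)
    (intro BO_I, simp add: orthogonal_matrix_transpose)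

lemma BO_orthogonal: "P \<in> BO \<Longrightarrow> orthogonal_matrix P"
  by (elim BO_E)
    (simp add: orthogonal_matrix transpose_block_diag block_diag_mult block_diag_mat1)

lemma compact_BO: "compact (BO :: ('t::finite, 'd::finite) bmat set)"
proof -
  let ?S = "{D :: real ^ 'd ^ 'd ^ 't. \<forall>t. orthogonal_matrix (D $ t)}"
  have "bounded ?S"
  proof (rule boundedI)
    fix D :: "real ^ 'd ^ 'd ^ 't" assume D: "D \<in> ?S"
    have "norm D \<le> (\<Sum>t\<in>UNIV. norm (D $ t))" by (simp add: norm_vec_def L2_set_le_sum)
    also have "\<dots> \<le> (\<Sum>t\<in>UNIV. \<Sum>i\<in>UNIV. norm (D $ t $ i))"
      by (rule sum_mono) (simp add: norm_vec_def L2_set_le_sum)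
    also have "\<dots> = (\<Sum>t\<in>(UNIV :: 't set). \<Sum>i\<in>(UNIV :: 'd set). 1)"
      using D by (intro sum.cong refl)
        (auto simp: orthogonal_matrix_orthonormal_rows row_def)
    finally show "norm D \<le> (\<Sum>t\<in>(UNIV :: 't set). \<Sum>i\<in>(UNIV :: 'd set). 1)" .
  qed
  moreover have "closed ?S"
    unfolding orthogonal_matrix transpose_def matrix_matrix_mult_def vec_eq_iff
    by (intro closed_Collect_all closed_Collect_eq closed_Collect_conj) (auto intro!: continuous_intros)
  ultimately have "compact ?S" by (simp add: compact_eq_bounded_closed)
  moreover have "continuous_on ?S (\<lambda>D. block_diag (\<lambda>t. D $ t))"
  proof -
    have "continuous_on ?S (\<lambda>D. if fst p = fst q then D $ fst p $ snd p $ snd q else 0)"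
      for p q :: "'t \<times> 'd"
      by (cases "fst p = fst q") (auto intro!: continuous_intros)
    then show ?thesis
      unfolding block_diag_def by (intro continuous_on_vec_lambda)
  qed
  ultimately have "compact ((\<lambda>D. block_diag (\<lambda>t. D $ t)) ` ?S)" by (rule compact_continuous_image[rotated])
  moreover have "(\<lambda>D. block_diag (\<lambda>t. D $ t)) ` ?S = BO"
  proof (intro equalityI subsetI)
    fix P :: "('t, 'd) bmat" assume "P \<in> BO"
    then obtain D where "P = block_diag D" "\<forall>t. orthogonal_matrix (D t)" by (auto simp: BO_def)
    then show "P \<in> (\<lambda>D. block_diag (\<lambda>t. D $ t)) ` ?S"
      by (intro image_eqI[of _ _ "\<chi> t. D t"]) auto
  qed (auto simp: BO_def)
  ultimately show ?thesis by simp
qed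

lemma d_ABW_attained:
  "\<exists>P\<in>BO. d_ABW L M = norm (L - M ** P) \<and> (\<forall>Q\<in>BO. norm (L - M ** P) \<le> norm (L - M ** Q))"
proof -
  have "continuous_on BO (\<lambda>P. norm (L - M ** P))"
    unfolding matrix_matrix_mult_def by (intro continuous_intros)
  then obtain P where P: "P \<in> BO" "\<forall>Q\<in>BO. norm (L - M ** P) \<le> norm (L - M ** Q)"
    using continuous_attains_inf[OF compact_BO] BO_mat1 by blast
  then have "d_ABW L M = norm (L - M ** P)"
    unfolding d_ABW_def by (intro cInf_eq_minimum) auto
  with P show ?thesis by blast
qed

lemma equiv_BO_rel:
  "equiv BL (BO_rel :: (('t::{finite,linorder}, 'd::finite) bmat \<times> ('t, 'd) bmat) set)"
proof (rule equivI)
  show "refl_on BL BO_rel"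
    by (rule refl_onI) (simp add: BO_rel_def bexI[OF _ BO_mat1])
  show "BO_rel \<subseteq> BL \<times> BL" by (auto simp: BO_rel_def)
  have flip: "(M, L) \<in> BO_rel" if LM: "(L, M) \<in> BO_rel" for L M :: "('t, 'd) bmat"
  proof -
    obtain P where "L \<in> BL" "M \<in> BL" and P: "P \<in> BO" "L = M ** P"
      using LM by (auto simp: BO_rel_def)
    moreover have "M = L ** transpose P"
      unfolding P(2) using BO_orthogonal[OF P(1)]
      by (simp only: orthogonal_matrix_def matrix_mul_assoc[symmetric] matrix_mul_rid)
    ultimately show ?thesis
      unfolding BO_rel_def using BO_transpose[OF P(1)] by blast
  qed
  then show "sym (BO_rel :: (('t, 'd) bmat \<times> ('t, 'd) bmat) set)" by (rule symI)
  show "trans (BO_rel :: (('t, 'd) bmat \<times> ('t, 'd) bmat) set)"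
  proof (rule transI)
    fix L M N :: "('t, 'd) bmat" assume "(L, M) \<in> BO_rel" "(M, N) \<in> BO_rel"
    then obtain P Q where "L \<in> BL" "N \<in> BL" and PQ: "P \<in> BO" "Q \<in> BO" "M = N ** Q" "L = M ** P"
      by (auto simp: BO_rel_def)
    moreover have "L = N ** (Q ** P)" unfolding PQ(4) PQ(3) by (rule matrix_mul_assoc[symmetric])
    ultimately show "(L, N) \<in> BO_rel"
      unfolding BO_rel_def using BO_mult[OF PQ(2,1)] by blast
  qed
qed

lemma norm_mult_orthogonal:
  fixes A :: "real ^ 'n::finite ^ 'm::finite"
  assumes "orthogonal_matrix P"
  shows "norm (A ** P) = norm A"
proof -
  have "(A ** P) $ i = transpose P *v A $ i" for i
    by (simp add: vec_eq_iff matrix_matrix_mult_def matrix_vector_mult_def transpose_def mult.commute)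
  moreover have "norm (transpose P *v x) = norm x" for x
  proof (rule orthogonal_transformation_norm)
    show "orthogonal_transformation ((*v) (transpose P))"
      unfolding orthogonal_transformation_matrix
      using assms by (simp del: transpose_matrix_vector add: matrix_vector_mul_linear)
  qed
  ultimately show ?thesis by (simp add: norm_vec_def)
qed

lemma d_ABW_mult_BO:
  fixes L M P Q :: "('t::finite, 'd::finite) bmat"
  assumes P: "P \<in> BO" and Q: "Q \<in> BO"
  shows "d_ABW (L ** P) (M ** Q) = d_ABW L M"
proof -
  have le: "d_ABW (L ** P) (M ** Q) \<le> d_ABW L M"
    if P: "P \<in> BO" and Q: "Q \<in> BO" for L M P Q :: "('t, 'd) bmat"
  proof -
    obtain R where R: "R \<in> BO" "d_ABW L M = norm (L - M ** R)"
      using d_ABW_attained by blast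
    obtain S where S: "d_ABW (L ** P) (M ** Q) \<le> norm (L ** P - M ** Q ** S)"
        "S = transpose Q ** (R ** P)"
      using d_ABW_attained[of "L ** P" "M ** Q"] BO_mult[OF BO_transpose[OF Q] BO_mult[OF R(1) P]]
      by metis
    have "M ** Q ** S = M ** ((Q ** transpose Q) ** (R ** P))"
      unfolding S(2) by (simp only: matrix_mul_assoc)
    also have "\<dots> = M ** R ** P"
      using BO_orthogonal[OF Q] by (simp add: orthogonal_matrix_def matrix_mul_assoc)
    finally have "L ** P - M ** Q ** S = (L - M ** R) ** P"
      by (simp add: vec_eq_iff matrix_matrix_mult_def left_diff_distrib sum_subtractf)
    then show ?thesis
      using S(1) R(2) by (simp add: norm_mult_orthogonal[OF BO_orthogonal[OF P]])
  qed
  have cancel: "A ** R ** transpose R = A" if "R \<in> BO" for A R :: "('t, 'd) bmat"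
    using BO_orthogonal[OF that]
    by (simp only: orthogonal_matrix_def matrix_mul_assoc[symmetric] matrix_mul_rid)
  show ?thesis
    using le[OF P Q, of L M]
      le[OF BO_transpose[OF P] BO_transpose[OF Q], of "L ** P" "M ** Q"]
    by (simp add: cancel P Q)
qed

lemma dq_cls:
  assumes "L \<in> BL" "M \<in> BL"
  shows "dq (cls L) (cls M) = d_ABW L M"
proof -
  have "d_ABW L' M' = d_ABW L M" if in_cls: "L' \<in> cls L" "M' \<in> cls M" for L' M'
  proof -
    obtain P Q where "P \<in> BO" "L = L' ** P" "Q \<in> BO" "M = M' ** Q"
      using in_cls unfolding cls_def BO_rel_def by blast
    then show ?thesis by (simp add: d_ABW_mult_BO)
  qed
  moreover have "L \<in> cls L" "M \<in> cls M"
    unfolding cls_def using equiv_class_self[OF equiv_BO_rel] assms by blast+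
  ultimately have "{d_ABW x y | x y. x \<in> cls L \<and> y \<in> cls M} = {d_ABW L M}" by blast
  then show ?thesis by (simp add: dq_def lift2_def)
qed

end

theory Submission
  imports Defs
begin

text \<open>
  Write \<open>E = P - 1\<close> for \<open>P\<close> block-orthogonal. A lower-triangular \<open>M\<close> is optimally aligned with \<open>L\<close>
  iff \<open>\<langle>L, M E\<rangle> \<le> 0\<close> for all such \<open>E\<close>. Since \<open>\<langle>L, L E\<rangle> = - |L E|\<^sup>2 / 2\<close>, and \<open>|L E| \<ge> c |E|\<close> when \<open>L\<close> is
  regular, alignment is stable at regular points: small \<open>V\<close> in \<open>calV L\<close>, for which
  \<open>\<langle>L, V E\<rangle> = - \<langle>L E, V E\<rangle> / 2\<close>, belong to \<open>bfV L\<close>; aligned representatives of interior points of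
  geodesics are unique, so that the geodesics are exactly the segments \<open>[L + u V]\<close> with \<open>V \<in> bfV L\<close>; and
  the distance of \<open>[L + u V]\<close> and \<open>[L + u W]\<close> is \<open>u |V - W|\<close> up to higher order, so that angles are
  Euclidean. The directions thus already form the whole unit sphere of \<open>calV L\<close>, which is complete,
  and the exponential map at a small \<open>V\<close> follows the segment from \<open>L\<close> to \<open>L + V\<close>.
\<close>

section \<open>Matrix products and block-diagonal matrices\<close>

lemma bounded_bilinear_matrix_mult:
  "bounded_bilinear ((**) :: real^'n::finite^'m::finite \<Rightarrow> real^'p::finite^'n \<Rightarrow> real^'p^'m)"
proof -
  have "bilinear ((**) :: real^'n^'m \<Rightarrow> real^'p^'n \<Rightarrow> real^'p^'m)"
    unfolding bilinear_def
    by (auto intro!: linearI simp: matrix_matrix_mult_def vec_eq_iff algebra_simps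
        sum.distrib sum_distrib_left)
  then show ?thesis by (simp add: bilinear_conv_bounded_bilinear)
qed

lemmas matrix_mult_diff_left = bounded_bilinear.diff_left[OF bounded_bilinear_matrix_mult]
  and matrix_mult_diff_right = bounded_bilinear.diff_right[OF bounded_bilinear_matrix_mult]
  and matrix_mult_add_left = bounded_bilinear.add_left[OF bounded_bilinear_matrix_mult]
  and matrix_mult_scaleR_left = bounded_bilinear.scaleR_left[OF bounded_bilinear_matrix_mult]

lemma inner_matrix_mult_right:
  fixes A :: "real^'n::finite^'m::finite"
  shows "A \<bullet> (B ** P) = (A ** transpose P) \<bullet> B"
proof -
  have "(\<Sum>j\<in>UNIV. \<Sum>k\<in>UNIV. A $ i $ j * (B $ i $ k * P $ k $ j))
      = (\<Sum>k\<in>UNIV. \<Sum>j\<in>UNIV. A $ i $ j * P $ k $ j * B $ i $ k)" for i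
    by (subst sum.swap) (simp add: mult_ac)
  then show ?thesis
    by (simp add: inner_vec_def matrix_matrix_mult_def transpose_def sum_distrib_left sum_distrib_right)
qed

lemma inner_transpose: "transpose A \<bullet> transpose B = A \<bullet> (B :: real^'n::finite^'m::finite)"
  by (simp add: inner_vec_def transpose_def) (rule sum.swap)

lemma inner_matrix_mult_left:
  fixes A :: "real^'n::finite^'m::finite"
  shows "A \<bullet> (B ** C) = (transpose B ** A) \<bullet> C"
  using inner_matrix_mult_right[of "transpose A" "transpose C" "transpose B"]
    inner_transpose[of A "B ** C"] inner_transpose[of "transpose B ** A" C]
  by (simp add: matrix_transpose_mul)

lemma inner_mult_orthogonal:
  fixes A :: "real^'n::finite^'m::finite"
  assumes "orthogonal_matrix P"
  shows "(A ** P) \<bullet> (B ** P) = A \<bullet> B"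
proof -
  have "(A ** P) \<bullet> (B ** P) = (A ** (P ** transpose P)) \<bullet> B"
    by (simp add: inner_matrix_mult_right matrix_mul_assoc)
  then show ?thesis using assms by (simp add: orthogonal_matrix_def)
qed

section \<open>Blocks and block-diagonal matrices\<close>

lemma sum_UNIV_prod: "(\<Sum>p\<in>UNIV. f p) = (\<Sum>s\<in>UNIV. \<Sum>i\<in>UNIV. f (s, i))"
  for f :: "'a::finite \<times> 'b::finite \<Rightarrow> real"
  by (subst UNIV_Times_UNIV[symmetric], subst sum.cartesian_product) (simp add: case_prod_beta)

text \<open>Pairing with a block-diagonal matrix only sees the diagonal blocks. This is what links
  optimality over \<open>BO\<close> to the conditions on diagonal blocks in \<open>calV\<close> and
  \<open>BL_reg\<close>.\<close>

lemma inner_block_diag: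
  fixes A :: "('t::finite, 'd::finite) bmat"
  shows "A \<bullet> block_diag D = (\<Sum>t\<in>UNIV. block A t t \<bullet> D t)"
proof -
  have "(\<Sum>u\<in>UNIV. \<Sum>j\<in>UNIV. A $ (t, i) $ (u, j) * (if t = u then D t $ i $ j else 0))
      = (\<Sum>j\<in>UNIV. A $ (t, i) $ (t, j) * D t $ i $ j)" for t i
  proof -
    have "(\<Sum>u\<in>UNIV. \<Sum>j\<in>UNIV. A $ (t, i) $ (u, j) * (if t = u then D t $ i $ j else 0))
      = (\<Sum>u\<in>UNIV. if t = u then (\<Sum>j\<in>UNIV. A $ (t, i) $ (t, j) * D t $ i $ j) else 0)"
      by (rule sum.cong) auto
    then show ?thesis by simp
  qed
  then show ?thesis
    by (simp add: inner_vec_def sum_UNIV_prod block_diag_def block_def cong del: if_weak_cong)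
qed

lemma block_mult_block_diag:
  "block (A ** block_diag D) s t = block A s t ** D t"
proof -
  have "(\<Sum>u\<in>UNIV. \<Sum>k\<in>UNIV. A $ (s, i) $ (u, k) * (if u = t then D u $ k $ j else 0))
      = (\<Sum>k\<in>UNIV. A $ (s, i) $ (t, k) * D t $ k $ j)" for i j
  proof -
    have "(\<Sum>u\<in>UNIV. \<Sum>k\<in>UNIV. A $ (s, i) $ (u, k) * (if u = t then D u $ k $ j else 0))
      = (\<Sum>u\<in>UNIV. if u = t then (\<Sum>k\<in>UNIV. A $ (s, i) $ (t, k) * D t $ k $ j) else 0)"
      by (rule sum.cong) auto
    then show ?thesis by simp
  qed
  then show ?thesis
    by (simp add: block_def vec_eq_iff matrix_matrix_mult_def block_diag_def sum_UNIV_prod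
        cong del: if_weak_cong)
qed

lemma block_transpose: "block (transpose A) s t = transpose (block A t s)"
  by (simp add: block_def transpose_def vec_eq_iff)

lemma linear_block: "linear (\<lambda>A :: ('t::finite, 'd::finite) bmat. block A s t)"
  by (rule linearI) (simp_all add: block_def vec_eq_iff)

lemma linear_transpose: "linear (transpose :: real^'n::finite^'m::finite \<Rightarrow> _)"
  by (rule linearI) (simp_all add: transpose_def vec_eq_iff)

lemma symmetric_matrix_inner_transpose:
  assumes "symmetric_matrix S"
  shows "S \<bullet> transpose A = S \<bullet> A"
  using inner_transpose[of S A] assms by (simp add: symmetric_matrix_def)

lemma subspace_symmetric_matrix: "subspace {A :: real^'n::finite^'n. symmetric_matrix A}"
  unfolding subspace_def symmetric_matrix_def
  by (simp add: linear_add[OF linear_transpose] linear_scale[OF linear_transpose]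
      linear_0[OF linear_transpose])

lemma linear_block_diag:
  "linear (\<lambda>D :: real^'d::finite^'d^'t::finite. block_diag (\<lambda>t. D $ t))"
  by (rule linearI) (simp_all add: block_diag_def vec_eq_iff)

text \<open>\<open>BO\<close> is not linear, but all differences \<open>P - mat 1\<close> lie in
  this subspace, on which a lower bound for \<open>L ** E\<close> can be proved.\<close>

lemma subspace_range_block_diag:
  "subspace (range block_diag :: ('t::finite, 'd::finite) bmat set)"
proof -
  have "(range block_diag :: ('t, 'd) bmat set)
      = (\<lambda>D :: real^'d^'d^'t. block_diag (\<lambda>t. D $ t)) ` UNIV"
  proof (intro equalityI subsetI)
    fix P :: "('t, 'd) bmat" assume "P \<in> range block_diag"
    then obtain D where "P = block_diag D" by blast
    then show "P \<in> (\<lambda>D :: real^'d^'d^'t. block_diag (\<lambda>t. D $ t)) ` UNIV"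
      by (intro image_eqI[of _ _ "\<chi> t. D t"]) auto
  qed auto
  then show ?thesis
    by (metis linear_subspace_image[OF linear_block_diag subspace_UNIV])
qed

lemma BO_subset_block_diag: "BO \<subseteq> range block_diag"
  by (auto simp: BO_def)

lemma subspace_BL: "subspace (BL :: ('t::{finite,linorder}, 'd::finite) bmat set)"
  unfolding subspace_def BL_def
  by (auto simp: linear_add[OF linear_block] linear_scale[OF linear_block] linear_0[OF linear_block])

lemma BL_mult_BO: "L \<in> BL \<Longrightarrow> P \<in> BO \<Longrightarrow> L ** P \<in> BL"
  by (auto simp: BL_def BO_def block_mult_block_diag)

lemma subspace_calV: "subspace (calV L)"
proof -
  have "linear (\<lambda>V. block (transpose V ** L) t t)" for t
    by (intro linear_compose[OF linear_compose, unfolded o_def, of transpose "\<lambda>V. V ** L" "\<lambda>V. block V t t"]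
        linear_block linear_transpose bounded_linear.linear
        bounded_bilinear.bounded_linear_left[OF bounded_bilinear_matrix_mult])
  then have *: "subspace {V. symmetric_matrix (block (transpose V ** L) t t)}" for t
    using linear_subspace_vimage[OF _ subspace_symmetric_matrix] by (fastforce simp: vimage_def)
  then have "subspace (BL \<inter> (\<Inter>t. {V. symmetric_matrix (block (transpose V ** L) t t)}))"
    by (intro subspace_inter subspace_Inter subspace_BL) auto
  moreover have "calV L = BL \<inter> (\<Inter>t. {V. symmetric_matrix (block (transpose V ** L) t t)})"
    by (auto simp: calV_def)
  ultimately show ?thesis by simp
qed

lemma transpose_mult_self_symmetric: "symmetric_matrix (block (transpose A ** A) t t)"
  by (simp add: symmetric_matrix_def block_transpose[symmetric] matrix_transpose_mul)

section \<open>Optimal alignment\<close>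

lemma norm_diff_mult_BO:
  assumes "P \<in> BO"
  shows "(norm (L - M ** P))\<^sup>2 = (norm L)\<^sup>2 + (norm M)\<^sup>2 - 2 * (L \<bullet> (M ** P))"
  by (simp add: power2_norm_eq_inner inner_diff inner_commute
      inner_mult_orthogonal[OF BO_orthogonal[OF assms]])

definition aligned :: "('t::finite, 'd::finite) bmat \<Rightarrow> ('t, 'd) bmat \<Rightarrow> bool" where
  "aligned L M \<longleftrightarrow> d_ABW L M = norm (L - M)"

lemma d_ABW_le: "P \<in> BO \<Longrightarrow> d_ABW L M \<le> norm (L - M ** P)"
  using d_ABW_attained by metis

lemma d_ABW_nonneg: "0 \<le> d_ABW L M"
  using d_ABW_attained by (metis norm_ge_zero)

lemma d_ABW_le_norm: "d_ABW L M \<le> norm (L - M)"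
  using d_ABW_le[OF BO_mat1] by simp

lemma BO_mult_transpose:
  assumes "P \<in> BO" shows "A ** P ** transpose P = A" "A ** transpose P ** P = A"
  using BO_orthogonal[OF assms] by (simp_all add: orthogonal_matrix_def matrix_mul_assoc[symmetric])

lemma d_ABW_commute: "d_ABW L M = d_ABW M L"
proof -
  have "d_ABW L M \<le> d_ABW M L" for L M :: "('a, 'b) bmat"
  proof -
    obtain P where P: "P \<in> BO" "d_ABW M L = norm (M - L ** P)"
      using d_ABW_attained by blast
    have "d_ABW L M \<le> norm (L - M ** transpose P)"
      by (rule d_ABW_le[OF BO_transpose[OF P(1)]])
    also have "\<dots> = norm ((L - M ** transpose P) ** P)"
      by (simp add: norm_mult_orthogonal[OF BO_orthogonal[OF P(1)]])
    also have "\<dots> = norm (M - L ** P)"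
      by (simp add: matrix_mult_diff_left BO_mult_transpose[OF P(1)] norm_minus_commute)
    finally show ?thesis using P by simp
  qed
  then show ?thesis by (simp add: order_antisym)
qed

lemma d_ABW_triangle: "d_ABW L N \<le> d_ABW L M + d_ABW M N"
proof -
  obtain P Q where P: "P \<in> BO" "d_ABW L M = norm (L - M ** P)"
    and Q: "Q \<in> BO" "d_ABW M N = norm (M - N ** Q)"
    using d_ABW_attained by meson
  have "d_ABW L N \<le> norm (L - N ** (Q ** P))"
    by (rule d_ABW_le[OF BO_mult[OF Q(1) P(1)]])
  also have "\<dots> = norm ((L - M ** P) + (M - N ** Q) ** P)"
    by (simp add: matrix_mult_diff_left matrix_mul_assoc)
  also have "\<dots> \<le> norm (L - M ** P) + norm (M - N ** Q)"
    by (metis norm_triangle_ineq norm_mult_orthogonal[OF BO_orthogonal[OF P(1)]])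
  finally show ?thesis using P Q by simp
qed

text \<open>The norm of \<open>M ** P\<close> does not depend on \<open>P\<close>, so minimising the
  distance to \<open>L\<close> amounts to maximising the inner product with
  \<open>L\<close>.\<close>

lemma aligned_iff: "aligned L M \<longleftrightarrow> (\<forall>P\<in>BO. L \<bullet> (M ** P) \<le> L \<bullet> M)"
proof -
  have eq: "norm (L - M) \<le> norm (L - M ** P) \<longleftrightarrow> L \<bullet> (M ** P) \<le> L \<bullet> M" if "P \<in> BO" for P
  proof -
    have "norm (L - M) \<le> norm (L - M ** P) \<longleftrightarrow> (norm (L - M))\<^sup>2 \<le> (norm (L - M ** P))\<^sup>2"
      by simp
    then show ?thesis
      using norm_diff_mult_BO[OF that, of L M] norm_diff_mult_BO[OF BO_mat1, of L M] by simp
  qed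
  have "aligned L M \<longleftrightarrow> (\<forall>P\<in>BO. norm (L - M) \<le> norm (L - M ** P))"
    unfolding aligned_def using d_ABW_attained[of L M] d_ABW_le_norm[of L M] by (metis order_antisym)
  then show ?thesis using eq by blast
qed

lemma aligned_commute: "aligned L M \<Longrightarrow> aligned M L"
  by (simp add: aligned_def d_ABW_commute[of M] norm_minus_commute)

lemma opt_BO_iff_aligned: "P \<in> opt_BO L M \<longleftrightarrow> P \<in> BO \<and> aligned L (M ** P)"
proof -
  have "d_ABW L (M ** P) = d_ABW L M" if "P \<in> BO"
    using d_ABW_mult_BO[OF BO_mat1 that, of L M] by simp
  then show ?thesis by (auto simp: opt_BO_def aligned_def)
qed

text \<open>The optimal \<open>P\<close> can be absorbed into \<open>M\<close>: the pair
  \<open>L + V\<close>, \<open>mat 1\<close> represents the same vector. From here on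
  \<open>bfV\<close> is handled through \<open>aligned\<close> only.\<close>

lemma bfV_iff:
  assumes "L \<in> BL"
  shows "V \<in> bfV L \<longleftrightarrow> V \<in> BL \<and> aligned L (L + V)"
proof
  assume "V \<in> bfV L"
  then obtain M P where "V = M ** P - L" "M \<in> BL" "P \<in> BO" "aligned L (M ** P)"
    by (auto simp: bfV_def opt_BO_iff_aligned)
  then show "V \<in> BL \<and> aligned L (L + V)"
    using assms by (auto intro: subspace_diff[OF subspace_BL] BL_mult_BO)
next
  assume "V \<in> BL \<and> aligned L (L + V)"
  then have "V = (L + V) ** mat 1 - L \<and> L + V \<in> BL \<and> mat 1 \<in> opt_BO L (L + V)"
    using assms by (auto simp: opt_BO_iff_aligned BO_mat1 intro: subspace_add[OF subspace_BL])
  then show "V \<in> bfV L" unfolding bfV_def by blast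
qed

section \<open>First-order conditions for alignment\<close>

definition unit_matrix :: "'n \<Rightarrow> 'n \<Rightarrow> real^'n^'n" where
  "unit_matrix a b = (\<chi> p q. if p = a \<and> q = b then 1 else 0)"

text \<open>Rotation by \<theta> in the plane of the coordinates \<open>i\<close> and
  \<open>j\<close>. It preserves norms, since the change of the squared norm is a multiple of sin^2
  + cos^2 - 1.\<close>

lemma orthogonal_matrix_givens:
  fixes i j :: "'n::finite"
  assumes "i \<noteq> j"
  shows "orthogonal_matrix (mat 1 + (cos \<theta> - 1) *\<^sub>R (unit_matrix i i + unit_matrix j j)
    + sin \<theta> *\<^sub>R (unit_matrix j i - unit_matrix i j))"
    (is "orthogonal_matrix ?R")
proof -
  have unit: "unit_matrix a b *v x = (x $ b) *\<^sub>R axis a 1" for a b x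
  proof -
    have "(\<Sum>q\<in>UNIV. (if p = a \<and> q = b then 1 else 0) * x $ q) = (if p = a then x $ b else 0)" for p
    proof -
      have "(\<Sum>q\<in>UNIV. (if p = a \<and> q = b then 1 else 0) * x $ q)
          = (\<Sum>q\<in>UNIV. if q = b then (if p = a then x $ q else 0) else 0)"
        by (rule sum.cong) auto
      then show ?thesis by simp
    qed
    then show ?thesis by (simp add: unit_matrix_def matrix_vector_mult_def vec_eq_iff axis_def)
  qed
  have R: "?R *v x = x + ((cos \<theta> - 1) * x $ i - sin \<theta> * x $ j) *\<^sub>R axis i 1
      + (sin \<theta> * x $ i + (cos \<theta> - 1) * x $ j) *\<^sub>R axis j 1" for x
    by (simp add: matrix_vector_mult_add_rdistrib matrix_vector_mult_diff_rdistrib unit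
        scaleR_matrix_vector_assoc[symmetric] algebra_simps)
  have "norm (?R *v x) = norm x" for x
  proof -
    define p q where "p = x $ i" and "q = x $ j"
    define \<alpha> \<beta> where "\<alpha> = (cos \<theta> - 1) * p - sin \<theta> * q" and "\<beta> = sin \<theta> * p + (cos \<theta> - 1) * q"
    have "?R *v x = x + \<alpha> *\<^sub>R axis i 1 + \<beta> *\<^sub>R axis j 1"
      by (simp add: R \<alpha>_def \<beta>_def p_def q_def)
    moreover have "(norm (x + \<alpha> *\<^sub>R v + \<beta> *\<^sub>R w))\<^sup>2
        = (norm x)\<^sup>2 + (2 * \<alpha> * p + 2 * \<beta> * q + \<alpha>\<^sup>2 + \<beta>\<^sup>2)"
      if "x \<bullet> v = p" "x \<bullet> w = q" "v \<bullet> v = 1" "w \<bullet> w = 1" "v \<bullet> w = 0" for v w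
      unfolding power2_norm_eq_inner
      using that inner_commute[of v x] inner_commute[of w x] inner_commute[of w v]
      by (simp add: inner_add_left inner_add_right power2_eq_square algebra_simps)
    moreover have "axis i (1::real) \<bullet> axis j 1 = 0"
      using assms(1) by (simp add: inner_axis_axis)
    ultimately have "(norm (?R *v x))\<^sup>2
        = (norm x)\<^sup>2 + (2 * \<alpha> * p + 2 * \<beta> * q + \<alpha>\<^sup>2 + \<beta>\<^sup>2)"
      by (simp add: inner_axis p_def q_def inner_axis_axis)
    also have "2 * \<alpha> * p + 2 * \<beta> * q + \<alpha>\<^sup>2 + \<beta>\<^sup>2
        = ((sin \<theta>)\<^sup>2 + (cos \<theta>)\<^sup>2 - 1) * (p\<^sup>2 + q\<^sup>2)"
      unfolding \<alpha>_def \<beta>_def by algebra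
    finally show ?thesis by simp
  qed
  then have "orthogonal_transformation ((*v) ?R)"
    by (simp add: orthogonal_transformation matrix_vector_mul_linear)
  then show ?thesis by (simp add: orthogonal_transformation_matrix)
qed

text \<open>Rotating the identity in the plane of \<open>i\<close> and \<open>j\<close> cannot
  increase the inner product with \<open>S\<close>, so the derivative at angle 0, an off-diagonal
  difference of \<open>S\<close>, vanishes.\<close>

lemma symmetric_matrix_of_trace_maximal:
  fixes S :: "real^'n::finite^'n"
  assumes max: "\<And>Q. orthogonal_matrix Q \<Longrightarrow> S \<bullet> Q \<le> S \<bullet> mat 1"
  shows "symmetric_matrix S"
proof -
  have "S $ j $ i = S $ i $ j" if "i \<noteq> j" for i j
  proof -
    have inner_unit: "S \<bullet> unit_matrix a b = S $ a $ b" for a b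
    proof -
      have "(\<Sum>q\<in>UNIV. S $ p $ q * (if p = a \<and> q = b then 1 else 0))
          = (if p = a then S $ a $ b else 0)" for p
        by (cases "p = a") (simp_all add: if_distrib cong: if_cong)
      then show ?thesis by (simp add: inner_vec_def unit_matrix_def)
    qed
    \<comment> \<open>The increment of the inner product with \<open>S\<close> from
      \<open>mat 1\<close> to the rotation by \<theta>.\<close>
    define g where "g = (\<lambda>\<theta>. (cos \<theta> - 1) * (S $ i $ i + S $ j $ j) + sin \<theta> * (S $ j $ i - S $ i $ j))"
    have "g \<theta> \<le> g 0" for \<theta>
      using max[OF orthogonal_matrix_givens[OF that], of \<theta>]
      by (simp add: g_def inner_add_right inner_diff_right inner_unit)
    moreover have "(g has_real_derivative (S $ j $ i - S $ i $ j)) (at 0)"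
      unfolding g_def by (auto intro!: derivative_eq_intros)
    ultimately have "S $ j $ i - S $ i $ j = 0"
      using DERIV_local_max[of g "S $ j $ i - S $ i $ j" 0 1] by auto
    then show ?thesis by simp
  qed
  then show ?thesis
    unfolding symmetric_matrix_def transpose_def vec_eq_iff by (metis vec_lambda_beta)
qed

text \<open>Alignment makes every diagonal block of \<open>transpose (L + V) ** L\<close>
  trace-maximal, hence symmetric; subtracting the symmetric block of \<open>transpose L ** L\<close>
  leaves the one of \<open>transpose V ** L\<close>.\<close>

lemma bfV_subset_calV:
  assumes L: "L \<in> BL"
  shows "bfV L \<subseteq> calV L"
proof
  fix V assume V: "V \<in> bfV L"
  then have VB: "V \<in> BL" and al: "aligned L (L + V)" using bfV_iff[OF L] by auto
  define S where "S = transpose (L + V) ** L"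
  have "symmetric_matrix (block (transpose V ** L) t t)" for t
  proof -
    have "symmetric_matrix (block S t t)"
    proof (rule symmetric_matrix_of_trace_maximal)
      fix Q :: "real^'b^'b" assume Q: "orthogonal_matrix Q"
      \<comment> \<open>Competitors that differ from the identity in block \<open>t\<close> only
        isolate the condition on that block.\<close>
      define D where "D = (\<lambda>s. if s = t then Q else mat 1)"
      have "block_diag D \<in> BO" using Q by (intro BO_I) (simp add: D_def orthogonal_matrix_id)
      then have "L \<bullet> ((L + V) ** block_diag D) \<le> L \<bullet> ((L + V) ** mat 1)"
        using al by (simp add: aligned_iff)
      then have "S \<bullet> block_diag D \<le> S \<bullet> block_diag (\<lambda>s. mat 1)"
        by (simp only: inner_matrix_mult_left[of L "L + V"] S_def block_diag_mat1)
      then have "(\<Sum>s\<in>UNIV. block S s s \<bullet> D s) \<le> (\<Sum>s\<in>UNIV. block S s s \<bullet> mat 1)"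
        by (simp add: inner_block_diag)
      moreover have "(\<Sum>s\<in>UNIV - {t}. block S s s \<bullet> D s) = (\<Sum>s\<in>UNIV - {t}. block S s s \<bullet> mat 1)"
        by (rule sum.cong) (auto simp: D_def)
      ultimately show "block S t t \<bullet> Q \<le> block S t t \<bullet> mat 1"
        by (simp add: sum.remove[of UNIV t] D_def)
    qed
    moreover have "block (transpose V ** L) t t = block S t t - block (transpose L ** L) t t"
      by (simp add: S_def linear_add[OF linear_transpose] matrix_mult_add_left
          linear_add[OF linear_block])
    ultimately show ?thesis
      using subspace_diff[OF subspace_symmetric_matrix] transpose_mult_self_symmetric[of L t] by simp
  qed
  with VB show "V \<in> calV L" by (simp add: calV_def)
qed

lemma self_mem_calV: "L \<in> BL \<Longrightarrow> L \<in> calV L"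
  by (simp add: calV_def transpose_mult_self_symmetric)

text \<open>The symmetry of the diagonal blocks makes the first-order term in \<open>P - 1\<close> vanish.\<close>

lemma calV_inner_defect:
  assumes V: "V \<in> calV L" and P: "P \<in> BO"
  shows "L \<bullet> (V ** (P - mat 1)) = - ((L ** (P - mat 1)) \<bullet> (V ** (P - mat 1))) / 2"
proof -
  obtain D where D: "P = block_diag D" using P by (rule BO_E)
  \<comment> \<open>Both sides pair the diagonal blocks of \<open>transpose V ** L\<close> with
    \<open>D t\<close> or its transpose, which symmetric blocks cannot tell apart.\<close>
  have "L \<bullet> (V ** transpose P) = L \<bullet> (V ** P)"
    using V by (simp add: inner_matrix_mult_left D transpose_block_diag inner_block_diag
        calV_def symmetric_matrix_inner_transpose)
  moreover have "(L ** P) \<bullet> V = L \<bullet> (V ** transpose P)"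
    by (simp add: inner_matrix_mult_right)
  ultimately show ?thesis
    using inner_mult_orthogonal[OF BO_orthogonal[OF P], of L V]
    by (simp add: matrix_mult_diff_right inner_diff field_simps)
qed

text \<open>Expand the square of \<open>L ** P - L\<close>, where both terms have the same norm. The
  result is negative unless \<open>L ** P = L\<close>; this is the coercive term of all later
  estimates.\<close>

lemma self_inner_defect:
  assumes P: "P \<in> BO"
  shows "L \<bullet> (L ** (P - mat 1)) = - (norm (L ** (P - mat 1)))\<^sup>2 / 2"
  using inner_mult_orthogonal[OF BO_orthogonal[OF P], of L L]
  by (simp add: power2_norm_eq_inner matrix_mult_diff_right inner_diff inner_commute field_simps)

lemma aligned_inner_defect:
  assumes "aligned L M" "P \<in> BO"
  shows "L \<bullet> (M ** (P - mat 1)) \<le> 0"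
  using assms by (simp add: aligned_iff matrix_mult_diff_right inner_diff)

lemma defect_mem_block_diag: "P \<in> BO \<Longrightarrow> P - mat 1 \<in> range block_diag"
  using BO_subset_block_diag BO_mat1 subspace_diff[OF subspace_range_block_diag] by blast

section \<open>Coercivity and stability of alignment at regular points\<close>

lemma BL_regD: "L \<in> BL_reg \<Longrightarrow> L \<in> BL"
  by (simp add: BL_reg_def)

text \<open>Multiplying by \<open>transpose L\<close> and reading off diagonal blocks leaves a
  positive definite matrix times \<open>D t\<close>, which vanishes only if \<open>D t\<close>
  does.\<close>

lemma BL_reg_injective:
  assumes L: "L \<in> BL_reg" and E: "E \<in> range block_diag" "L ** E = 0"
  shows "E = 0"
proof -
  obtain D where D: "E = block_diag D" using E by blast
  have "D t = 0" for t
  proof -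
    let ?S = "block (transpose L ** L) t t"
    have "(transpose L ** L) ** block_diag D = 0"
      using E(2) D by (simp add: matrix_mul_assoc[symmetric])
    then have "?S ** D t = 0"
      using block_mult_block_diag[of "transpose L ** L" D t t] linear_0[OF linear_block] by metis
    then have "?S *v (D t *v x) = 0" for x
      by (simp add: matrix_vector_mul_assoc)
    moreover have "y = 0" if "?S *v y = 0" for y
    proof (rule ccontr)
      assume "y \<noteq> 0"
      then have "y \<bullet> (?S *v y) > 0"
        using L unfolding BL_reg_def positive_definite_def by blast
      then show False using that by simp
    qed
    ultimately show ?thesis by (simp add: matrix_eq)
  qed
  then show ?thesis by (simp add: D block_diag_def vec_eq_iff)
qed

text \<open>An injective linear map on a finite-dimensional subspace is bounded below.\<close>

lemma BL_reg_coercive: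
  assumes L: "L \<in> BL_reg"
  shows "\<exists>c>0. \<forall>E\<in>range block_diag. c * norm E \<le> norm (L ** E)"
  using injective_imp_isometric[OF closed_subspace[OF subspace_range_block_diag]
      subspace_range_block_diag bounded_bilinear.bounded_linear_right[OF bounded_bilinear_matrix_mult, of L]]
    BL_reg_injective[OF L] by auto

text \<open>With E = P - 1, the contribution of \<open>V\<close> to the inner product is at most |L
  E| |V E| / 2 and that of \<open>L\<close> is -|L E|^2 / 2. For small \<open>V\<close>, coercivity
  gives |V E| \<le> |L E| uniformly in \<open>P\<close>, so the sum is not positive.\<close>

lemma small_calV_mem_bfV:
  fixes L :: "('t::{finite,linorder}, 'd::finite) bmat"
  assumes L: "L \<in> BL_reg"
  shows "\<exists>\<delta>>0. \<forall>V\<in>calV L. norm V \<le> \<delta> \<longrightarrow> V \<in> bfV L"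
proof -
  obtain c where c: "c > 0" "\<And>E. E \<in> range block_diag \<Longrightarrow> c * norm E \<le> norm (L ** E)"
    using BL_reg_coercive[OF L] by blast
  obtain K where K: "K > 0" "\<And>(A :: ('t, 'd) bmat) (B :: ('t, 'd) bmat). norm (A ** B) \<le> norm A * norm B * K"
    using bounded_bilinear.pos_bounded[OF bounded_bilinear_matrix_mult] by metis
  \<comment> \<open>The radius \<open>c / K\<close> balances the coercivity constant against the
    bound for matrix products.\<close>
  have "V \<in> bfV L" if V: "V \<in> calV L" "norm V \<le> c / K" for V
  proof -
    have "L \<bullet> ((L + V) ** P) \<le> L \<bullet> (L + V)" if P: "P \<in> BO" for P
    proof -
      define E where "E = P - mat 1"
      have "norm (V ** E) \<le> norm V * norm E * K" by (rule K(2))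
      also have "\<dots> = (norm V * K) * norm E" by simp
      also have "\<dots> \<le> c * norm E"
        using V(2) K(1) by (intro mult_right_mono) (simp_all add: field_simps)
      also have "\<dots> \<le> norm (L ** E)"
        unfolding E_def by (rule c(2)[OF defect_mem_block_diag[OF P]])
      finally have VE: "norm (V ** E) \<le> norm (L ** E)" .
      have "- ((L ** E) \<bullet> (V ** E)) \<le> norm (L ** E) * norm (V ** E)"
        using Cauchy_Schwarz_ineq2[of "L ** E" "V ** E"] by linarith
      also have "\<dots> \<le> (norm (L ** E))\<^sup>2"
        using VE by (simp add: power2_eq_square mult_left_mono)
      finally have "L \<bullet> (L ** E) + L \<bullet> (V ** E) \<le> 0"
        using calV_inner_defect[OF V(1) P] self_inner_defect[OF P, of L] by (simp add: E_def)
      then show ?thesis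
        by (simp add: E_def matrix_mult_diff_right matrix_mult_add_left inner_diff inner_add)
    qed
    then show ?thesis
      using V(1) bfV_iff[OF BL_regD[OF L]] by (simp add: aligned_iff calV_def)
  qed
  moreover have "c / K > 0" using c(1) K(1) by simp
  ultimately show ?thesis by blast
qed

text \<open>Write \<open>L + u *\<^sub>R V\<close> as (1 - u) L + u (L + V): by alignment the second
  summand contributes nothing positive.\<close>

lemma segment_inner_defect:
  assumes L: "L \<in> BL" and V: "V \<in> bfV L" and u: "0 \<le> u" and P: "P \<in> BO"
  shows "L \<bullet> ((L + u *\<^sub>R V) ** (P - mat 1)) \<le> (1 - u) * (L \<bullet> (L ** (P - mat 1)))"
proof -
  have "L \<bullet> ((L + V) ** (P - mat 1)) \<le> 0"
    using V by (intro aligned_inner_defect P) (simp add: bfV_iff[OF L])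
  then have "u * (L \<bullet> ((L + V) ** (P - mat 1))) \<le> 0"
    using u by (simp add: mult_nonneg_nonpos)
  then show ?thesis
    by (simp add: matrix_mult_add_left matrix_mult_scaleR_left inner_add algebra_simps)
qed

lemma scaleR_mem_bfV:
  assumes L: "L \<in> BL" and V: "V \<in> bfV L" and u: "0 \<le> u" "u \<le> 1"
  shows "u *\<^sub>R V \<in> bfV L"
proof -
  have "L \<bullet> ((L + u *\<^sub>R V) ** P) \<le> L \<bullet> (L + u *\<^sub>R V)" if P: "P \<in> BO" for P
  proof -
    have "(1 - u) * (L \<bullet> (L ** (P - mat 1))) \<le> 0"
      using u(2) self_inner_defect[OF P, of L] by (simp add: mult_nonneg_nonpos)
    then have "L \<bullet> ((L + u *\<^sub>R V) ** (P - mat 1)) \<le> 0"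
      using segment_inner_defect[OF L V u(1) P] by simp
    then show ?thesis by (simp add: matrix_mult_diff_right inner_diff)
  qed
  then show ?thesis
    using V by (auto simp: bfV_iff[OF L] aligned_iff intro: subspace_scale[OF subspace_BL])
qed

text \<open>Testing the alignment of \<open>L + W\<close> with \<open>transpose P\<close> bounds the
  defect of the segment point from below by 0, while \<open>segment_inner_defect\<close> bounds it
  from above by a positive multiple, as u < 1, of -|L E|^2. Hence L E = 0 and P = 1.\<close>

lemma aligned_representative_unique:
  assumes L: "L \<in> BL_reg" and V: "V \<in> bfV L" and W: "W \<in> bfV L" and u: "0 \<le> u" "u < 1"
    and P: "P \<in> BO" "L + W = (L + u *\<^sub>R V) ** P"
  shows "W = u *\<^sub>R V"
proof -
  note LB = BL_regD[OF L]
  have "L \<bullet> ((L + W) ** transpose P) \<le> L \<bullet> (L + W)"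
    using W BO_transpose[OF P(1)] by (simp add: bfV_iff[OF LB] aligned_iff)
  then have "0 \<le> L \<bullet> ((L + u *\<^sub>R V) ** (P - mat 1))"
    unfolding P(2) by (simp add: BO_mult_transpose[OF P(1)] matrix_mult_diff_right inner_diff)
  also have "\<dots> \<le> (1 - u) * (L \<bullet> (L ** (P - mat 1)))"
    by (rule segment_inner_defect[OF LB V u(1) P(1)])
  finally have "0 \<le> L \<bullet> (L ** (P - mat 1))"
    using u(2) by (simp add: zero_le_mult_iff)
  then have "L ** (P - mat 1) = 0"
    using self_inner_defect[OF P(1), of L] by simp
  then have "P - mat 1 = 0"
    by (rule BL_reg_injective[OF L defect_mem_block_diag[OF P(1)]])
  then show ?thesis using P(2) by simp
qed

text \<open>The two terms of order \<open>u\<close> are absorbed by the coercive term of order \<open>1\<close>, so that the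
  optimal \<open>P\<close> is \<open>O(u\<^sup>2)\<close>-close to the identity.\<close>

lemma d_ABW_segments_lower_bound:
  fixes L :: "('t::{finite,linorder}, 'd::finite) bmat"
  assumes L: "L \<in> BL_reg" and V: "V \<in> bfV L" and W: "W \<in> bfV L"
  shows "\<exists>K. \<forall>u\<in>{0..1/4}.
    u\<^sup>2 * (norm (V - W))\<^sup>2 - K * u ^ 4 \<le> (d_ABW (L + u *\<^sub>R V) (L + u *\<^sub>R W))\<^sup>2"
proof -
  note LB = BL_regD[OF L]
  obtain c where c: "c > 0" "\<And>E. E \<in> range block_diag \<Longrightarrow> c * norm E \<le> norm (L ** E)"
    using BL_reg_coercive[OF L] by blast
  obtain K where K: "K > 0" "\<And>(A :: ('t, 'd) bmat) (B :: ('t, 'd) bmat). norm (A ** B) \<le> norm A * norm B * K"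
    using bounded_bilinear.pos_bounded[OF bounded_bilinear_matrix_mult] by metis
  define k where "k = norm V * (norm W * K)"
  have "u\<^sup>2 * (norm (V - W))\<^sup>2 - 2 * k\<^sup>2 / c\<^sup>2 * u ^ 4 \<le> (d_ABW (L + u *\<^sub>R V) (L + u *\<^sub>R W))\<^sup>2"
    if u: "0 \<le> u" "u \<le> 1 / 4" for u
  proof -
    let ?A = "L + u *\<^sub>R V" and ?B = "L + u *\<^sub>R W"
    obtain P where P: "P \<in> BO" "d_ABW ?A ?B = norm (?A - ?B ** P)"
      using d_ABW_attained by blast
    define E where "E = P - mat 1"
    define a where "a = L \<bullet> (L ** E)"
    define e where "e = norm E"
    have e: "a \<le> - (c * e)\<^sup>2 / 2"
    proof -
      have "(c * e)\<^sup>2 \<le> (norm (L ** E))\<^sup>2"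
        unfolding e_def E_def using c(1)
        by (intro power_mono c(2) defect_mem_block_diag[OF P(1)]) simp
      then show ?thesis using self_inner_defect[OF P(1), of L] by (simp add: a_def E_def)
    qed
    have "L \<bullet> ((L + W) ** E) \<le> 0"
      unfolding E_def using W by (intro aligned_inner_defect P(1)) (simp add: bfV_iff[OF LB])
    then have LW: "L \<bullet> (W ** E) \<le> - a"
      by (simp add: a_def matrix_mult_add_left inner_add)
    \<comment> \<open>Alignment is symmetric, so \<open>V\<close> can be treated in the left
      argument as \<open>W\<close> was in the right one.\<close>
    have "(L + V) \<bullet> (L ** E) \<le> 0"
      unfolding E_def using V
      by (intro aligned_inner_defect[OF aligned_commute P(1)]) (simp add: bfV_iff[OF LB])
    then have VL: "V \<bullet> (L ** E) \<le> - a"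
      by (simp add: a_def inner_add)
    have VW: "V \<bullet> (W ** E) \<le> k * e"
    proof -
      have "V \<bullet> (W ** E) \<le> norm V * norm (W ** E)" by (rule norm_cauchy_schwarz)
      also have "\<dots> \<le> norm V * (norm W * norm E * K)" by (intro mult_left_mono K(2)) simp
      finally show ?thesis by (simp add: k_def e_def mult_ac)
    qed
    have "?A \<bullet> (?B ** E) = a + u * (V \<bullet> (L ** E)) + u * (L \<bullet> (W ** E)) + u\<^sup>2 * (V \<bullet> (W ** E))"
      by (simp add: a_def matrix_mult_add_left matrix_mult_scaleR_left inner_add power2_eq_square
          algebra_simps)
    also have "\<dots> \<le> a + u * (- a) + u * (- a) + u\<^sup>2 * (k * e)"
      using LW VL VW u by (intro add_mono mult_left_mono order_refl) auto
    also have "\<dots> = (1 - 2 * u) * a + u\<^sup>2 * k * e" by (simp add: algebra_simps)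
    \<comment> \<open>The bound u \<le> 1/4 keeps at least half of the nonpositive term
      \<open>a\<close>.\<close>
    also have "\<dots> \<le> (1 / 2) * a + u\<^sup>2 * k * e"
    proof -
      have "a \<le> 0" using e zero_le_power2[of "c * e"] by linarith
      then have "(1 - 2 * u) * a \<le> (1 / 2) * a" using u(2) by (intro mult_right_mono_neg) simp_all
      then show ?thesis by simp
    qed
    also have "\<dots> \<le> - (c * e)\<^sup>2 / 4 + u\<^sup>2 * k * e" using e by simp
    \<comment> \<open>Completing the square in \<open>e\<close> removes the dependence on
      \<open>P\<close>; the price is of order u^4.\<close>
    also have "\<dots> \<le> u ^ 4 * k\<^sup>2 / c\<^sup>2"
    proof -
      define h where "h = u\<^sup>2 * k / c"
      have h: "c * h = u\<^sup>2 * k" using c(1) by (simp add: h_def)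
      have "0 \<le> (c * e / 2 - h)\<^sup>2" by simp
      also have "\<dots> = (c * e)\<^sup>2 / 4 - (c * h) * e + h\<^sup>2"
        by (simp add: power2_eq_square algebra_simps)
      finally show ?thesis
        unfolding h by (simp add: h_def power_divide power_mult_distrib)
    qed
    finally have AB: "?A \<bullet> (?B ** E) \<le> u ^ 4 * k\<^sup>2 / c\<^sup>2" .
    have "(norm (?A - ?B ** P))\<^sup>2 = (norm (?A - ?B))\<^sup>2 - 2 * (?A \<bullet> (?B ** E))"
      using norm_diff_mult_BO[OF P(1), of ?A ?B] norm_diff_mult_BO[OF BO_mat1, of ?A ?B]
      by (simp add: E_def matrix_mult_diff_right inner_diff_right)
    moreover have "(norm (?A - ?B))\<^sup>2 = u\<^sup>2 * (norm (V - W))\<^sup>2"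
    proof -
      have "?A - ?B = u *\<^sub>R (V - W)" by (simp add: scaleR_diff_right)
      then show ?thesis by (simp only: norm_scaleR power_mult_distrib power2_abs)
    qed
    moreover have "2 * k\<^sup>2 / c\<^sup>2 * u ^ 4 = 2 * (u ^ 4 * k\<^sup>2 / c\<^sup>2)" by simp
    ultimately show ?thesis unfolding P(2) using AB by linarith
  qed
  then show ?thesis by (intro exI[of _ "2 * k\<^sup>2 / c\<^sup>2"]) auto
qed

section \<open>Geodesics\<close>

lemma cls_eq_iff:
  assumes "L \<in> BL" "M \<in> BL"
  shows "cls L = cls M \<longleftrightarrow> (\<exists>P\<in>BO. L = M ** P)"
  unfolding cls_def using eq_equiv_class_iff[OF equiv_BO_rel assms] assms by (simp add: BO_rel_def)

lemma cls_mem_BL_quot: "L \<in> BL \<Longrightarrow> cls L \<in> BL_quot"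
  by (simp add: cls_def BL_quot_def quotientI)

lemma BL_quotE:
  assumes "X \<in> BL_quot"
  obtains M where "M \<in> BL" "X = cls M"
  using assms unfolding BL_quot_def cls_def by (auto elim: quotientE)

text \<open>Extensional like the curves in \<open>Geod\<close>, so that a geodesic can be equal to a
  segment rather than only agree with it on [0,1].\<close>

definition seg :: "('t::{finite,linorder}, 'd::finite) bmat \<Rightarrow> ('t, 'd) bmat \<Rightarrow> ('t, 'd) curve" where
  "seg L V = (\<lambda>u\<in>{0..1}. cls (L + u *\<^sub>R V))"

lemma segment_mem_BL:
  assumes "L \<in> BL" "V \<in> bfV L"
  shows "L + u *\<^sub>R V \<in> BL"
  using assms bfV_iff[OF assms(1)]
  by (blast intro: subspace_add[OF subspace_BL] subspace_scale[OF subspace_BL])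

text \<open>The given representatives yield the upper bounds. If some piece were shorter, the
  triangle inequality would make the distance from \<open>L\<close> to \<open>L + V\<close> less
  than \<open>norm V\<close>, against alignment.\<close>

lemma d_ABW_segment:
  assumes L: "L \<in> BL" and V: "V \<in> bfV L" and u: "u \<in> {0..1}" and v: "v \<in> {0..1}"
  shows "d_ABW (L + u *\<^sub>R V) (L + v *\<^sub>R V) = \<bar>u - v\<bar> * norm V"
proof -
  have le: "d_ABW (L + s *\<^sub>R V) (L + t *\<^sub>R V) \<le> \<bar>s - t\<bar> * norm V" for s t
  proof -
    have "(L + s *\<^sub>R V) - (L + t *\<^sub>R V) = (s - t) *\<^sub>R V" by (simp add: scaleR_left_diff_distrib)
    then show ?thesis
      using d_ABW_le_norm[of "L + s *\<^sub>R V" "L + t *\<^sub>R V"] by (simp only: norm_scaleR)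
  qed
  have *: "d_ABW (L + s *\<^sub>R V) (L + t *\<^sub>R V) = \<bar>s - t\<bar> * norm V"
    if st: "0 \<le> s" "s \<le> t" "t \<le> 1" for s t
  proof -
    have "norm V = d_ABW L (L + V)"
      using V by (simp add: bfV_iff[OF L] aligned_def)
    also have "\<dots> \<le> d_ABW L (L + s *\<^sub>R V) + d_ABW (L + s *\<^sub>R V) (L + t *\<^sub>R V) + d_ABW (L + t *\<^sub>R V) (L + V)"
      using d_ABW_triangle[of L "L + V" "L + s *\<^sub>R V"]
        d_ABW_triangle[of "L + s *\<^sub>R V" "L + V" "L + t *\<^sub>R V"] by linarith
    also have "\<dots> \<le> s * norm V + d_ABW (L + s *\<^sub>R V) (L + t *\<^sub>R V) + (1 - t) * norm V"
      using le[of 0 s] le[of t 1] st by simp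
    finally show ?thesis using le[of s t] st by (simp add: algebra_simps)
  qed
  show ?thesis
  proof (cases "u \<le> v")
    case True
    then show ?thesis using * u v by simp
  next
    case False
    then show ?thesis
      using *[of v u] u v d_ABW_commute[of "L + u *\<^sub>R V"] by (simp add: abs_minus_commute)
  qed
qed

lemma d_ABW_segment_origin:
  assumes "L \<in> BL" "V \<in> bfV L" "u \<in> {0..1}"
  shows "d_ABW L (L + u *\<^sub>R V) = u * norm V"
  using d_ABW_segment[OF assms(1,2) _ assms(3), of 0] assms(3) by simp

lemma seg_mem_Geod:
  assumes L: "L \<in> BL" and V: "V \<in> bfV L"
  shows "seg L V \<in> Geod (cls L)"
proof -
  have "dq (seg L V u) (seg L V v) = \<bar>u - v\<bar> * norm V" if "u \<in> {0..1}" "v \<in> {0..1}" for u v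
    using that by (simp add: seg_def dq_cls segment_mem_BL[OF L V] d_ABW_segment[OF L V])
  moreover from this[of 0 1] have "dq (seg L V 0) (seg L V 1) = norm V" by simp
  moreover have "seg L V \<in> {0..1} \<rightarrow>\<^sub>E BL_quot"
    unfolding seg_def by (auto intro: cls_mem_BL_quot segment_mem_BL[OF L V])
  ultimately show ?thesis by (simp add: Geod_def seg_def)
qed

lemma seg_mem_Geod0:
  assumes L: "L \<in> BL" and V: "V \<in> bfV L - {0}"
  shows "seg L V \<in> Geod0 (cls L)"
proof -
  have "dq (cls L) (seg L V 1) = norm V"
    using V d_ABW_segment_origin[OF L, of V 1] segment_mem_BL[OF L, of V 1]
    by (simp add: seg_def dq_cls L)
  moreover have "dq (cls L) (const_geod (cls L) 1) = 0"
    using d_ABW_le_norm[of L L] d_ABW_nonneg[of L L] by (simp add: const_geod_def dq_cls L)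
  ultimately have "seg L V \<noteq> const_geod (cls L)" using V by auto
  then show ?thesis using seg_mem_Geod[OF L] V by (simp add: Geod0_def)
qed

text \<open>Equality in the triangle inequality, realised by representatives aligned with \<open>N\<close>, puts \<open>N\<close>
  on a segment.\<close>

lemma between_segment:
  assumes BL: "L \<in> BL" "M \<in> BL" "N \<in> BL" and u: "0 \<le> u" "u \<le> 1"
    and LN: "d_ABW L N = u * d_ABW L M" and NM: "d_ABW N M = (1 - u) * d_ABW L M"
  obtains V where "V \<in> bfV L" "cls M = cls (L + V)" "cls N = cls (L + u *\<^sub>R V)"
proof -
  define D where "D = d_ABW L M"
  obtain P where P: "P \<in> BO" "d_ABW N L = norm (N - L ** P)" using d_ABW_attained by blast
  obtain Q where Q: "Q \<in> BO" "d_ABW N M = norm (N - M ** Q)" using d_ABW_attained by blast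
  \<comment> \<open>\<open>N\<close> is kept fixed and both ends are rotated to be aligned with
    it.\<close>
  define x z where "x = L ** P" and "z = M ** Q"
  have xN: "norm (x - N) = u * D"
    using P(2) LN by (simp add: x_def D_def d_ABW_commute[of N] norm_minus_commute)
  have Nz: "norm (N - z) = (1 - u) * D"
    using Q(2) NM by (simp add: z_def D_def)
  have D: "d_ABW x z = D" unfolding x_def z_def D_def by (rule d_ABW_mult_BO[OF P(1) Q(1)])
  \<comment> \<open>The distance \<open>D\<close> of the classes is at most |x - z|, and the
    triangle inequality through \<open>N\<close> gives the converse bound; equality makes the three
    points collinear.\<close>
  then have "dist x z = dist x N + dist N z"
    using d_ABW_le_norm[of x z] xN Nz norm_triangle_ineq[of "x - N" "N - z"]
    by (simp add: dist_norm algebra_simps)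
  then have xz: "norm (x - z) = D" and eq: "(u * D) *\<^sub>R (N - z) = ((1 - u) * D) *\<^sub>R (x - N)"
    using dist_triangle_eq[of x z N] xN Nz by (simp_all add: dist_norm algebra_simps)
  have N: "N = x + u *\<^sub>R (z - x)"
  proof (cases "D = 0")
    case True
    then show ?thesis using xN xz by simp
  next
    case False
    have "D *\<^sub>R (u *\<^sub>R (N - z)) = D *\<^sub>R ((1 - u) *\<^sub>R (x - N))"
      using eq by (simp add: mult.commute)
    then have "u *\<^sub>R (N - z) = (1 - u) *\<^sub>R (x - N)"
      using False by (metis scaleR_left_imp_eq)
    then show ?thesis by (simp add: algebra_simps)
  qed
  \<comment> \<open>Rotating back by \<open>transpose P\<close> makes the segment start at
    \<open>L\<close> itself.\<close>
  define V where "V = z ** transpose P - L"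
  have LV: "L + V = M ** (Q ** transpose P)" by (simp add: V_def z_def matrix_mul_assoc)
  have "N ** transpose P = L + u *\<^sub>R V"
    by (simp add: N V_def x_def matrix_mult_add_left matrix_mult_scaleR_left matrix_mult_diff_left
        BO_mult_transpose[OF P(1)])
  then have NV: "N = (L + u *\<^sub>R V) ** P"
    using BO_mult_transpose(2)[OF P(1), of N] by simp
  have QP: "Q ** transpose P \<in> BO" by (intro BO_mult BO_transpose P Q)
  have LVB: "L + V \<in> BL" unfolding LV by (intro BL_mult_BO BL QP)
  then have VB: "V \<in> BL" using subspace_diff[OF subspace_BL LVB BL(1)] by simp
  have "aligned L (L + V)"
  proof -
    have "d_ABW L (L + V) = D"
      unfolding LV D_def using d_ABW_mult_BO[OF BO_mat1 QP, of L M] by simp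
    moreover have "norm (L - (L + V)) = norm ((L - (L + V)) ** P)"
      by (simp add: norm_mult_orthogonal[OF BO_orthogonal[OF P(1)]])
    moreover have "(L - (L + V)) ** P = x - z"
      by (simp add: V_def x_def matrix_mult_diff_left BO_mult_transpose[OF P(1)]
          del: diff_diff_eq2 add: algebra_simps)
    ultimately show ?thesis by (simp add: aligned_def xz)
  qed
  then have V: "V \<in> bfV L" using VB by (simp add: bfV_iff[OF BL(1)])
  moreover have "cls (L + V) = cls M"
    unfolding cls_eq_iff[OF LVB BL(2)] using LV QP by blast
  moreover have "cls N = cls (L + u *\<^sub>R V)"
    unfolding cls_eq_iff[OF BL(3) segment_mem_BL[OF BL(1) V]] using NV P(1) by blast
  ultimately show ?thesis using that by simp
qed

lemma cls_segment_unique: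
  assumes L: "L \<in> BL_reg" and V: "V \<in> bfV L" and W: "W \<in> bfV L" and u: "0 \<le> u" "u < 1"
    and eq: "cls (L + W) = cls (L + u *\<^sub>R V)"
  shows "W = u *\<^sub>R V"
proof -
  note LB = BL_regD[OF L]
  have "L + W \<in> BL" using segment_mem_BL[OF LB W, of 1] by simp
  then obtain P where "P \<in> BO" "L + W = (L + u *\<^sub>R V) ** P"
    using eq cls_eq_iff[OF _ segment_mem_BL[OF LB V]] by blast
  then show ?thesis by (rule aligned_representative_unique[OF L V W u])
qed

text \<open>The points of \<gamma> at the times 0, s u and u realise equality in the triangle
  inequality with ratio \<open>s\<close>, so \<open>between_segment\<close> applies.\<close>

lemma Geod_chord:
  assumes L: "L \<in> BL" and \<gamma>: "\<gamma> \<in> Geod (cls L)" and u: "u \<in> {0..1}" and s: "s \<in> {0..1}"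
  obtains V where "V \<in> bfV L" "\<gamma> u = cls (L + V)" "\<gamma> (s * u) = cls (L + s *\<^sub>R V)"
proof -
  have su: "s * u \<in> {0..1}" using u s by (auto simp: mult_le_one)
  have "\<gamma> u \<in> BL_quot" "\<gamma> (s * u) \<in> BL_quot"
    using \<gamma> u su by (auto simp: Geod_def)
  then obtain M N where M: "M \<in> BL" "\<gamma> u = cls M" and N: "N \<in> BL" "\<gamma> (s * u) = cls N"
    by (metis BL_quotE)
  define D where "D = dq (\<gamma> 0) (\<gamma> 1)"
  have \<gamma>0: "\<gamma> 0 = cls L" using \<gamma> by (simp add: Geod_def)
  have d: "dq (\<gamma> a) (\<gamma> b) = \<bar>a - b\<bar> * D" if "a \<in> {0..1}" "b \<in> {0..1}" for a b
    using \<gamma> that by (simp add: Geod_def D_def)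
  have LM: "d_ABW L M = u * D"
    using d[of 0 u] u by (simp add: \<gamma>0 M dq_cls L)
  have "d_ABW L N = s * u * D"
    using d[OF _ su, of 0] su by (simp add: \<gamma>0 N dq_cls L)
  then have LN: "d_ABW L N = s * d_ABW L M" using LM by simp
  have "d_ABW N M = \<bar>s * u - u\<bar> * D"
    using d[OF su u] by (simp add: N M dq_cls)
  moreover have "\<bar>s * u - u\<bar> = (1 - s) * u"
    using u s mult_right_mono[of s 1 u] by (simp add: algebra_simps)
  ultimately have NM: "d_ABW N M = (1 - s) * d_ABW L M" using LM by simp
  show ?thesis
    using between_segment[OF L M(1) N(1) _ _ LN NM] s that M(2) N(2) by auto
qed

text \<open>Interior points of a geodesic have a unique aligned representative, so the segments
  reaching different points of the geodesic all have the same direction.\<close>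

lemma Geod_eq_seg:
  assumes L: "L \<in> BL_reg" and \<gamma>: "\<gamma> \<in> Geod (cls L)"
  shows "\<exists>V\<in>bfV L. \<gamma> = seg L V"
proof -
  note LB = BL_regD[OF L]
  \<comment> \<open>These are chords to the endpoint \<gamma> 1. Its aligned representative might
    not be unique, so the vector may depend on \<open>u\<close> at this stage.\<close>
  have "\<forall>u\<in>{0..1}. \<exists>V. V \<in> bfV L \<and> \<gamma> 1 = cls (L + V) \<and> \<gamma> u = cls (L + u *\<^sub>R V)"
  proof
    fix u :: real assume u: "u \<in> {0..1}"
    show "\<exists>V. V \<in> bfV L \<and> \<gamma> 1 = cls (L + V) \<and> \<gamma> u = cls (L + u *\<^sub>R V)"
      by (rule Geod_chord[OF LB \<gamma> _ u, of 1]) auto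
  qed
  then obtain V where V: "\<And>u. u \<in> {0..1} \<Longrightarrow> V u \<in> bfV L"
      "\<And>u. u \<in> {0..1} \<Longrightarrow> \<gamma> 1 = cls (L + V u)"
      "\<And>u. u \<in> {0..1} \<Longrightarrow> \<gamma> u = cls (L + u *\<^sub>R V u)"
    by metis
  have VV: "V v = V u" if uv: "0 < v" "v \<le> u" "u < 1" for u v
  proof -
    have mem: "u \<in> {0..1}" "v \<in> {0..1}" "v / u \<in> {0..1}" using uv by auto
    \<comment> \<open>The chord to the interior point \<gamma> u links the two times: uniqueness at
      \<open>u\<close> identifies \<open>W\<close>, and uniqueness at \<open>v\<close> then compares
      \<open>V u\<close> with \<open>V v\<close>.\<close>
    obtain W where W: "W \<in> bfV L" "\<gamma> u = cls (L + W)" "\<gamma> (v / u * u) = cls (L + (v / u) *\<^sub>R W)"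
      using Geod_chord[OF LB \<gamma> mem(1,3)] .
    have "W = u *\<^sub>R V u"
      using W(2) V(3)[OF mem(1)] uv
      by (intro cls_segment_unique[OF L V(1)[OF mem(1)] W(1)]) auto
    then have "cls (L + v *\<^sub>R V u) = cls (L + v *\<^sub>R V v)"
      using W(3) V(3)[OF mem(2)] uv by simp
    then have "v *\<^sub>R V u = v *\<^sub>R V v"
      using uv by (intro cls_segment_unique[OF L V(1)[OF mem(2)]]
          scaleR_mem_bfV[OF LB V(1)[OF mem(1)]]) auto
    then show ?thesis using uv by simp
  qed
  \<comment> \<open>Any interior time would serve. The endpoints need separate arguments below, as
    uniqueness covers interior times only.\<close>
  define W where "W = V (1 / 2)"
  have W: "W \<in> bfV L" by (simp add: W_def V(1))
  have "\<gamma> u = cls (L + u *\<^sub>R W)" if u: "u \<in> {0..1}" for u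
  proof -
    consider "u = 0" | "0 < u" "u < 1" | "u = 1" using u by fastforce
    then show ?thesis
    proof cases
      case 1
      then show ?thesis using \<gamma> by (simp add: Geod_def)
    next
      case 2
      then have "V u = W"
        using VV[of u "1 / 2"] VV[of "1 / 2" u] by (cases "u \<le> 1 / 2") (auto simp: W_def)
      then show ?thesis using V(3)[OF u] by simp
    next
      case 3
      then show ?thesis using V(2)[of "1 / 2"] by (simp add: W_def)
    qed
  qed
  moreover have "\<gamma> \<in> extensional {0..1}" using \<gamma> by (simp add: Geod_def PiE_def)
  ultimately have "\<gamma> = seg L W"
    unfolding seg_def by (intro extensionalityI[of _ "{0..1}"]) auto
  with W show ?thesis by blast
qed

lemma Geod0_eq_seg:
  assumes L: "L \<in> BL_reg" and \<gamma>: "\<gamma> \<in> Geod0 (cls L)"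
  obtains V where "V \<in> bfV L - {0}" "\<gamma> = seg L V"
proof -
  obtain V where V: "V \<in> bfV L" "\<gamma> = seg L V"
    using Geod_eq_seg[OF L] \<gamma> by (auto simp: Geod0_def)
  moreover have "V \<noteq> 0"
  proof
    assume "V = 0"
    then have "\<gamma> = const_geod (cls L)" by (simp add: V(2) seg_def const_geod_def)
    then show False using \<gamma> by (simp add: Geod0_def)
  qed
  ultimately show ?thesis using that by blast
qed

lemma geod_vec_seg:
  assumes L: "L \<in> BL_reg" and V: "V \<in> bfV L - {0}"
  shows "geod_vec L (seg L V) = V"
  unfolding geod_vec_def
proof (rule the_equality)
  show "V \<in> bfV L - {0} \<and> (\<forall>u\<in>{0..1}. seg L V u = cls (L + u *\<^sub>R V))"
    using V by (simp add: seg_def)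
next
  fix W assume W: "W \<in> bfV L - {0} \<and> (\<forall>u\<in>{0..1}. seg L V u = cls (L + u *\<^sub>R W))"
  \<comment> \<open>The midpoint is used because uniqueness of aligned representatives is available
    for u < 1 only.\<close>
  then have "cls (L + (1 / 2) *\<^sub>R W) = cls (L + (1 / 2) *\<^sub>R V)"
    by (auto simp: seg_def dest!: bspec[of _ _ "1 / 2"])
  then have "(1 / 2) *\<^sub>R W = (1 / 2) *\<^sub>R V"
    using V W by (intro cls_segment_unique[OF L] scaleR_mem_bfV[OF BL_regD[OF L]]) auto
  then show "W = V" by simp
qed

section \<open>Angles\<close>

lemma angle_eqI:
  assumes "0 \<le> a" "a \<le> pi"
    and lim: "((\<lambda>u. ((dq X (\<gamma> u))\<^sup>2 + (dq X (\<eta> u))\<^sup>2 - (dq (\<gamma> u) (\<eta> u))\<^sup>2)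
      / (2 * dq X (\<gamma> u) * dq X (\<eta> u))) \<longlongrightarrow> cos a) (at_right 0)"
  shows "angle X \<gamma> \<eta> = a"
  unfolding angle_def
proof (rule the_equality)
  fix b assume b: "0 \<le> b \<and> b \<le> pi \<and> ((\<lambda>u. ((dq X (\<gamma> u))\<^sup>2 + (dq X (\<eta> u))\<^sup>2 - (dq (\<gamma> u) (\<eta> u))\<^sup>2)
      / (2 * dq X (\<gamma> u) * dq X (\<eta> u))) \<longlongrightarrow> cos b) (at_right 0)"
  then have "cos b = cos a"
    using tendsto_unique[OF trivial_limit_at_right_real _ lim] by blast
  then show "b = a" using b assms(1,2) by (simp add: cos_inj_pi)
qed (use assms in auto)

lemma abs_inner_sgn_le_1: "\<bar>sgn V \<bullet> sgn W\<bar> \<le> 1" for V W :: "'a::real_inner"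
proof -
  have "norm (sgn V) * norm (sgn W) \<le> 1" by (simp add: norm_sgn)
  then show ?thesis using Cauchy_Schwarz_ineq2[of "sgn V" "sgn W"] by linarith
qed

text \<open>The difference quotient is squeezed between \<open>q\<close> and q + O(u^2): the
  distance of the points at time \<open>u\<close> is at most u |V - W|, and
  \<open>d_ABW_segments_lower_bound\<close> controls it from below.\<close>

lemma angle_seg:
  assumes L: "L \<in> BL_reg" and V: "V \<in> bfV L - {0}" and W: "W \<in> bfV L - {0}"
  shows "angle (cls L) (seg L V) (seg L W) = arccos (sgn V \<bullet> sgn W)"
proof (rule angle_eqI)
  note LB = BL_regD[OF L]
  have abs: "\<bar>sgn V \<bullet> sgn W\<bar> \<le> 1" by (rule abs_inner_sgn_le_1)
  then show "0 \<le> arccos (sgn V \<bullet> sgn W)" "arccos (sgn V \<bullet> sgn W) \<le> pi"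
    by (auto intro: arccos_lbound arccos_ubound)
  define q where "q = sgn V \<bullet> sgn W"
  define c where "c = norm V * norm W"
  have c: "c > 0" using V W by (simp add: c_def)
  have q: "V \<bullet> W = c * q" using V W by (simp add: q_def c_def sgn_div_norm field_simps)
  obtain K where K: "\<And>u. u \<in> {0..1/4} \<Longrightarrow>
      u\<^sup>2 * (norm (V - W))\<^sup>2 - K * u ^ 4 \<le> (d_ABW (L + u *\<^sub>R V) (L + u *\<^sub>R W))\<^sup>2"
    using d_ABW_segments_lower_bound[OF L, of V W] V W by blast
  let ?f = "\<lambda>u. ((dq (cls L) (seg L V u))\<^sup>2 + (dq (cls L) (seg L W u))\<^sup>2 - (dq (seg L V u) (seg L W u))\<^sup>2)
      / (2 * dq (cls L) (seg L V u) * dq (cls L) (seg L W u))"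
  have bounds: "q \<le> ?f u \<and> ?f u \<le> q + K * u\<^sup>2 / (2 * c)" if u: "0 < u" "u \<le> 1 / 4" for u
  proof -
    define d where "d = d_ABW (L + u *\<^sub>R V) (L + u *\<^sub>R W)"
    have "dq (cls L) (seg L V u) = u * norm V" "dq (cls L) (seg L W u) = u * norm W"
        "dq (seg L V u) (seg L W u) = d"
      using u V W segment_mem_BL[OF LB, of V u] segment_mem_BL[OF LB, of W u]
      by (simp_all add: seg_def dq_cls LB d_ABW_segment_origin d_def)
    then have f: "?f u = (u\<^sup>2 * ((norm V)\<^sup>2 + (norm W)\<^sup>2) - d\<^sup>2) / (2 * u\<^sup>2 * c)"
      by (simp add: c_def power_mult_distrib power2_eq_square algebra_simps)
    have VW: "(norm V)\<^sup>2 + (norm W)\<^sup>2 = (norm (V - W))\<^sup>2 + 2 * c * q"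
      by (simp add: power2_norm_eq_inner inner_diff inner_commute flip: q)
    have "(L + u *\<^sub>R V) - (L + u *\<^sub>R W) = u *\<^sub>R (V - W)" by (simp add: scaleR_diff_right)
    then have "d \<le> u * norm (V - W)"
      using d_ABW_le_norm[of "L + u *\<^sub>R V" "L + u *\<^sub>R W"] u by (simp add: d_def)
    then have "d\<^sup>2 \<le> (u * norm (V - W))\<^sup>2"
      by (intro power_mono) (auto simp: d_def d_ABW_nonneg)
    then have "2 * u\<^sup>2 * c * q \<le> u\<^sup>2 * ((norm V)\<^sup>2 + (norm W)\<^sup>2) - d\<^sup>2"
      by (simp add: VW power_mult_distrib algebra_simps)
    moreover have "u\<^sup>2 * ((norm V)\<^sup>2 + (norm W)\<^sup>2) - d\<^sup>2 \<le> 2 * u\<^sup>2 * c * q + K * u ^ 4"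
      using K[of u] u by (simp add: VW d_def algebra_simps)
    moreover have "q + K * u\<^sup>2 / (2 * c) = (2 * u\<^sup>2 * c * q + K * u ^ 4) / (2 * u\<^sup>2 * c)"
      using u c by (simp add: field_simps power4_eq_xxxx power2_eq_square)
    ultimately show ?thesis
      unfolding f using u c by (simp add: pos_le_divide_eq divide_right_mono mult_ac)
  qed
  have ev: "\<forall>\<^sub>F u in at_right 0. 0 < u \<and> u \<le> (1 / 4 :: real)"
    unfolding eventually_at_right_field by (intro exI[of _ "1 / 4"]) auto
  have "(?f \<longlongrightarrow> q) (at_right 0)"
  proof (rule tendsto_sandwich)
    show "\<forall>\<^sub>F u in at_right 0. q \<le> ?f u"
      using ev by eventually_elim (use bounds in blast)
    show "\<forall>\<^sub>F u in at_right 0. ?f u \<le> q + K * u\<^sup>2 / (2 * c)"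
      using ev by eventually_elim (use bounds in blast)
    have "((\<lambda>u. q + K * u\<^sup>2 / (2 * c)) \<longlongrightarrow> q + K * 0\<^sup>2 / (2 * c)) (at_right 0)"
      using c by (intro tendsto_intros) auto
    then show "((\<lambda>u. q + K * u\<^sup>2 / (2 * c)) \<longlongrightarrow> q) (at_right 0)" by simp
  qed simp
  then show "(?f \<longlongrightarrow> cos (arccos (sgn V \<bullet> sgn W))) (at_right 0)"
    using abs by (simp add: q_def cos_arccos_abs)
qed

lemma lift2_eqI:
  assumes "x0 \<in> X" "y0 \<in> Y" and "\<And>x y. x \<in> X \<Longrightarrow> y \<in> Y \<Longrightarrow> f x y = c"
  shows "lift2 f X Y = c"
proof -
  have "{f x y | x y. x \<in> X \<and> y \<in> Y} = {c}"
  proof (intro equalityI subsetI)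
    show "z \<in> {f x y | x y. x \<in> X \<and> y \<in> Y}" if "z \<in> {c}" for z
      using that assms(1,2) assms(3)[OF assms(1,2)] by blast
  qed (use assms(3) in blast)
  then show ?thesis by (simp add: lift2_def)
qed

section \<open>Completion of a subset of the unit sphere for the angular metric\<close>

lemma norm_diff_unit_sq:
  fixes x y :: "'a::real_inner"
  assumes "norm x = 1" "norm y = 1"
  shows "(norm (x - y))\<^sup>2 = 2 - 2 * (x \<bullet> y)"
  using assms by (simp add: norm_eq_1 power2_norm_eq_inner inner_diff inner_commute)

lemma abs_inner_unit_le_1:
  fixes x y :: "'a::real_inner"
  assumes "norm x = 1" "norm y = 1"
  shows "\<bar>x \<bullet> y\<bar> \<le> 1"
  using Cauchy_Schwarz_ineq2[of x y] assms by simp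

text \<open>A chord is no longer than its arc: for the angle \<open>a\<close>, the chord is 2 sin
  (a/2).\<close>

lemma norm_diff_le_arccos:
  fixes x y :: "'a::real_inner"
  assumes "norm x = 1" "norm y = 1"
  shows "norm (x - y) \<le> arccos (x \<bullet> y)"
proof -
  define a where "a = arccos (x \<bullet> y)"
  have a: "cos a = x \<bullet> y" "0 \<le> a"
    using abs_inner_unit_le_1[OF assms] by (auto simp: a_def cos_arccos_abs arccos_lbound)
  have "\<bar>sin (a / 2)\<bar> \<le> \<bar>a / 2\<bar>" by (rule abs_sin_x_le_abs_x)
  then have "(sin (a / 2))\<^sup>2 \<le> (a / 2)\<^sup>2" by (simp only: abs_le_square_iff)
  moreover have "cos a = 1 - 2 * (sin (a / 2))\<^sup>2" using cos_double_sin[of "a / 2"] by simp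
  ultimately have "(norm (x - y))\<^sup>2 \<le> a\<^sup>2"
    using norm_diff_unit_sq[OF assms] a by (simp add: power_divide)
  then show ?thesis using a(2) by (simp add: a_def power2_le_iff_abs_le abs_le_square_iff)
qed

lemma arccos_inner_eq_0_iff:
  fixes x y :: "'a::real_inner"
  assumes "norm x = 1" "norm y = 1"
  shows "arccos (x \<bullet> y) = 0 \<longleftrightarrow> x = y"
proof
  assume "arccos (x \<bullet> y) = 0"
  then show "x = y" using norm_diff_le_arccos[OF assms] by simp
qed (use assms in \<open>simp add: norm_eq_1\<close>)

lemma tendsto_arccos_inner:
  fixes f g :: "nat \<Rightarrow> 'a::real_inner"
  assumes f: "f \<longlonglongrightarrow> x" and g: "g \<longlonglongrightarrow> y"
    and unit: "\<And>n. norm (f n) = 1" "\<And>n. norm (g n) = 1" "norm x = 1" "norm y = 1"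
  shows "(\<lambda>n. arccos (f n \<bullet> g n)) \<longlonglongrightarrow> arccos (x \<bullet> y)"
proof (rule continuous_on_tendsto_compose[OF continuous_on_arccos'])
  show "(\<lambda>n. f n \<bullet> g n) \<longlonglongrightarrow> x \<bullet> y" by (intro tendsto_inner f g)
  show "x \<bullet> y \<in> {-1..1}" using abs_inner_unit_le_1[OF unit(3,4)] by auto
  show "\<forall>\<^sub>F n in sequentially. f n \<bullet> g n \<in> {-1..1}"
    using abs_inner_unit_le_1[OF unit(1,2)] by (auto simp: abs_le_iff minus_le_iff)
qed

text \<open>Uniform converse of the chord estimate: \<open>d\<close> is the chord that belongs to
  the angle \<open>e\<close>.\<close>

lemma arccos_inner_small:
  assumes "e > 0"
  obtains d where "d > 0" "\<And>x y :: 'a::real_inner.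
    norm x = 1 \<Longrightarrow> norm y = 1 \<Longrightarrow> norm (x - y) < d \<Longrightarrow> arccos (x \<bullet> y) < e"
proof -
  \<comment> \<open>Capping at \<open>pi\<close> stays in the range where \<open>arccos\<close>
    inverts \<open>cos\<close>.\<close>
  define e' where "e' = min e pi"
  have e': "0 < e'" "e' \<le> pi" "e' \<le> e" using assms by (auto simp: e'_def)
  then have cos: "cos e' < 1" using cos_monotone_0_pi[of 0 e'] by simp
  define d where "d = sqrt (2 - 2 * cos e')"
  have "arccos (x \<bullet> y) < e" if xy: "norm x = 1" "norm y = 1" "norm (x - y) < d" for x y :: 'a
  proof -
    have "(norm (x - y))\<^sup>2 < d\<^sup>2" using xy(3) by (intro power_strict_mono) auto
    then have "cos e' < x \<bullet> y" using norm_diff_unit_sq[OF xy(1,2)] cos by (simp add: d_def)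
    then have "arccos (x \<bullet> y) < arccos (cos e')"
      using abs_inner_unit_le_1[OF xy(1,2)] by (intro arccos_less_arccos) auto
    then show ?thesis using e' by (simp add: arccos_cos)
  qed
  moreover have "d > 0" using cos by (simp add: d_def)
  ultimately show ?thesis using that by blast
qed

text \<open>Models a set of directions by a closed set of unit vectors, with the angle as distance.
  Closedness is what makes the completion add nothing.\<close>

locale angular =
  fixes D :: "'a set" and \<delta> :: "'a \<Rightarrow> 'a \<Rightarrow> real" and \<pi> :: "'a \<Rightarrow> 'v::euclidean_space"
  assumes inj: "inj_on \<pi> D" and closed: "closed (\<pi> ` D)"
    and unit: "\<And>a. a \<in> D \<Longrightarrow> norm (\<pi> a) = 1"
    and \<delta>: "\<And>a b. a \<in> D \<Longrightarrow> b \<in> D \<Longrightarrow> \<delta> a b = arccos (\<pi> a \<bullet> \<pi> b)"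
begin

text \<open>Chords are bounded by angles, so the images form a Cauchy sequence in norm; the limit
  stays in the closed image.\<close>

lemma cauchy_seqs_convergent:
  assumes "x \<in> cauchy_seqs D \<delta>"
  obtains a where "a \<in> D" "(\<lambda>n. \<pi> (x n)) \<longlonglongrightarrow> \<pi> a"
proof -
  have xD: "\<And>n. x n \<in> D" using assms by (auto simp: cauchy_seqs_def)
  have "Cauchy (\<lambda>n. \<pi> (x n))"
  proof (rule CauchyI)
    fix e :: real assume "e > 0"
    then obtain N where "\<forall>m\<ge>N. \<forall>n\<ge>N. \<delta> (x m) (x n) < e"
      using assms by (auto simp: cauchy_seqs_def)
    then show "\<exists>N. \<forall>m\<ge>N. \<forall>n\<ge>N. norm (\<pi> (x m) - \<pi> (x n)) < e"
      using norm_diff_le_arccos[OF unit[OF xD] unit[OF xD]] \<delta>[OF xD xD]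
      by (metis order_le_less_trans)
  qed
  then obtain v where v: "(\<lambda>n. \<pi> (x n)) \<longlonglongrightarrow> v" by (auto simp: Cauchy_convergent_iff convergent_def)
  have "v \<in> \<pi> ` D"
    by (rule closed_sequentially[OF closed _ v]) (use xD in auto)
  then show ?thesis using that v by auto
qed

lemma convergent_cauchy_seqs:
  assumes xD: "\<And>n. x n \<in> D" and v: "(\<lambda>n. \<pi> (x n)) \<longlonglongrightarrow> v"
  shows "x \<in> cauchy_seqs D \<delta>"
proof -
  have "\<exists>N. \<forall>m\<ge>N. \<forall>n\<ge>N. \<delta> (x m) (x n) < e" if e: "e > 0" for e
  proof -
    obtain d where d: "d > 0" "\<And>x y :: 'v. norm x = 1 \<Longrightarrow> norm y = 1 \<Longrightarrow> norm (x - y) < d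
        \<Longrightarrow> arccos (x \<bullet> y) < e"
      using arccos_inner_small[OF e, where 'a = 'v] by metis
    obtain N where "\<forall>m\<ge>N. \<forall>n\<ge>N. norm (\<pi> (x m) - \<pi> (x n)) < d"
      using CauchyD[OF LIMSEQ_imp_Cauchy[OF v] d(1)] by blast
    then show ?thesis using d(2) unit[OF xD] by (intro exI[of _ N]) (simp add: \<delta> xD)
  qed
  then show ?thesis using xD by (auto simp: cauchy_seqs_def)
qed

text \<open>For unit vectors, convergence in angle and in norm agree, so a class consists of all
  sequences in \<open>D\<close> whose images share one limit.\<close>

lemma cauchy_rel_class:
  assumes xD: "\<And>n. x n \<in> D" and a: "a \<in> D" and lim: "(\<lambda>n. \<pi> (x n)) \<longlonglongrightarrow> \<pi> a"
  shows "cauchy_rel D \<delta> `` {x} = {y. range y \<subseteq> D \<and> (\<lambda>n. \<pi> (y n)) \<longlonglongrightarrow> \<pi> a}"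
proof (intro equalityI subsetI)
  fix y assume "y \<in> cauchy_rel D \<delta> `` {x}"
  then have y: "y \<in> cauchy_seqs D \<delta>" "(\<lambda>n. \<delta> (x n) (y n)) \<longlonglongrightarrow> 0" by (auto simp: cauchy_rel_def)
  then have yD: "\<And>n. y n \<in> D" by (auto simp: cauchy_seqs_def)
  have "(\<lambda>n. \<pi> (x n) - \<pi> (y n)) \<longlonglongrightarrow> 0"
  proof (rule Lim_null_comparison[OF _ y(2)])
    show "\<forall>\<^sub>F n in sequentially. norm (\<pi> (x n) - \<pi> (y n)) \<le> \<delta> (x n) (y n)"
      using norm_diff_le_arccos[OF unit[OF xD] unit[OF yD]] by (simp add: \<delta> xD yD)
  qed
  then have "(\<lambda>n. \<pi> (x n) - (\<pi> (x n) - \<pi> (y n))) \<longlonglongrightarrow> \<pi> a - 0"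
    by (intro tendsto_diff lim)
  then show "y \<in> {y. range y \<subseteq> D \<and> (\<lambda>n. \<pi> (y n)) \<longlonglongrightarrow> \<pi> a}" using yD by auto
next
  fix y assume "y \<in> {y. range y \<subseteq> D \<and> (\<lambda>n. \<pi> (y n)) \<longlonglongrightarrow> \<pi> a}"
  then have yD: "\<And>n. y n \<in> D" and y: "(\<lambda>n. \<pi> (y n)) \<longlonglongrightarrow> \<pi> a" by auto
  have "(\<lambda>n. \<delta> (x n) (y n)) \<longlonglongrightarrow> arccos (\<pi> a \<bullet> \<pi> a)"
    using tendsto_arccos_inner[OF lim y] by (simp add: \<delta> xD yD unit a)
  then show "y \<in> cauchy_rel D \<delta> `` {x}"
    using arccos_inner_eq_0_iff[of "\<pi> a" "\<pi> a"] unit[OF a]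
    by (simp add: cauchy_rel_def convergent_cauchy_seqs[OF xD lim] convergent_cauchy_seqs[OF yD y])
qed

lemma embed_eq:
  "a \<in> D \<Longrightarrow> completion_embed D \<delta> a = {y. range y \<subseteq> D \<and> (\<lambda>n. \<pi> (y n)) \<longlonglongrightarrow> \<pi> a}"
  unfolding completion_embed_def by (rule cauchy_rel_class) simp_all

text \<open>Every Cauchy sequence has a limit in \<open>D\<close>, so its class also contains a
  constant sequence.\<close>

lemma completion_eq: "completion D \<delta> = completion_embed D \<delta> ` D"
proof (intro equalityI subsetI)
  fix C assume "C \<in> completion D \<delta>"
  then obtain x where x: "x \<in> cauchy_seqs D \<delta>" "C = cauchy_rel D \<delta> `` {x}"
    unfolding completion_def by (elim quotientE)
  obtain a where a: "a \<in> D" "(\<lambda>n. \<pi> (x n)) \<longlonglongrightarrow> \<pi> a"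
    using cauchy_seqs_convergent[OF x(1)] .
  have "\<And>n. x n \<in> D" using x by (auto simp: cauchy_seqs_def)
  then show "C \<in> completion_embed D \<delta> ` D"
    using cauchy_rel_class[OF _ a] x(2) embed_eq[OF a(1)] a(1) by blast
next
  fix C assume "C \<in> completion_embed D \<delta> ` D"
  then obtain a where "a \<in> D" "C = cauchy_rel D \<delta> `` {\<lambda>n. a}" by (auto simp: completion_embed_def)
  moreover have "(\<lambda>n. a) \<in> cauchy_seqs D \<delta>"
    using \<open>a \<in> D\<close> by (intro convergent_cauchy_seqs[of _ "\<pi> a"]) auto
  ultimately show "C \<in> completion D \<delta>" by (simp add: completion_def quotientI)
qed

lemma completion_dist_embed:
  assumes a: "a \<in> D" and b: "b \<in> D"
  shows "completion_dist \<delta> (completion_embed D \<delta> a) (completion_embed D \<delta> b) = arccos (\<pi> a \<bullet> \<pi> b)"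
  unfolding completion_dist_def
proof (rule lift2_eqI)
  show "(\<lambda>n. a) \<in> completion_embed D \<delta> a" "(\<lambda>n. b) \<in> completion_embed D \<delta> b"
    using a b by (auto simp: embed_eq)
  show "lim (\<lambda>n. \<delta> (x n) (y n)) = arccos (\<pi> a \<bullet> \<pi> b)"
    if xy: "x \<in> completion_embed D \<delta> a" "y \<in> completion_embed D \<delta> b" for x y
  proof (rule limI)
    have "\<And>n. x n \<in> D" "\<And>n. y n \<in> D" "(\<lambda>n. \<pi> (x n)) \<longlonglongrightarrow> \<pi> a" "(\<lambda>n. \<pi> (y n)) \<longlonglongrightarrow> \<pi> b"
      using xy a b by (auto simp: embed_eq)
    then show "(\<lambda>n. \<delta> (x n) (y n)) \<longlonglongrightarrow> arccos (\<pi> a \<bullet> \<pi> b)"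
      using tendsto_arccos_inner[of "\<lambda>n. \<pi> (x n)" "\<pi> a" "\<lambda>n. \<pi> (y n)" "\<pi> b"]
      by (simp add: \<delta> unit a b)
  qed
qed

end

section \<open>The tangent cone at a regular point\<close>

definition dirvec ::
    "('t::{finite,linorder}, 'd::finite) bmat \<Rightarrow> ('t, 'd) curve \<Rightarrow> ('t, 'd) bmat" where
  "dirvec L \<gamma> = sgn (geod_vec L \<gamma>)"

locale regular_point =
  fixes L :: "('t::{finite,linorder}, 'd::finite) bmat"
  assumes L: "L \<in> BL_reg"
begin

abbreviation "X \<equiv> cls L"

lemma LB: "L \<in> BL"
  by (rule BL_regD[OF L])

lemma dirvec_seg: "V \<in> bfV L - {0} \<Longrightarrow> dirvec L (seg L V) = sgn V"
  by (simp add: dirvec_def geod_vec_seg[OF L])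

lemma seg_geod_vec:
  assumes "\<gamma> \<in> Geod0 X"
  shows "geod_vec L \<gamma> \<in> bfV L - {0}" "seg L (geod_vec L \<gamma>) = \<gamma>"
  using Geod0_eq_seg[OF L assms] geod_vec_seg[OF L] by metis+

lemma geod_vec_eq_scaleR_dirvec: "geod_vec L \<gamma> = norm (geod_vec L \<gamma>) *\<^sub>R dirvec L \<gamma>"
  by (cases "geod_vec L \<gamma> = 0") (simp_all add: dirvec_def sgn_div_norm)

lemma norm_dirvec: "\<gamma> \<in> Geod0 X \<Longrightarrow> norm (dirvec L \<gamma>) = 1"
  using seg_geod_vec(1) by (simp add: dirvec_def norm_sgn)

lemma dirvec_mem_calV: "\<gamma> \<in> Geod0 X \<Longrightarrow> dirvec L \<gamma> \<in> calV L"
  using seg_geod_vec(1) bfV_subset_calV[OF LB]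
  by (auto simp: dirvec_def sgn_div_norm intro: subspace_scale[OF subspace_calV])

lemma dq_endpoint:
  assumes "\<gamma> \<in> Geod0 X"
  shows "dq X (\<gamma> 1) = norm (geod_vec L \<gamma>)"
proof -
  have "dq X (seg L V 1) = norm V" if "V \<in> bfV L" for V
    using that d_ABW_segment_origin[OF LB that, of 1] segment_mem_BL[OF LB that, of 1]
    by (simp add: seg_def dq_cls LB)
  then show ?thesis using seg_geod_vec[OF assms] by (metis DiffD1)
qed

lemma angle_eq:
  "\<gamma> \<in> Geod0 X \<Longrightarrow> \<eta> \<in> Geod0 X \<Longrightarrow> angle X \<gamma> \<eta> = arccos (dirvec L \<gamma> \<bullet> dirvec L \<eta>)"
  using angle_seg[OF L seg_geod_vec(1) seg_geod_vec(1)] by (simp add: seg_geod_vec(2) dirvec_def)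

lemma angle_eq_0_iff:
  "\<gamma> \<in> Geod0 X \<Longrightarrow> \<eta> \<in> Geod0 X \<Longrightarrow> angle X \<gamma> \<eta> = 0 \<longleftrightarrow> dirvec L \<gamma> = dirvec L \<eta>"
  by (simp add: angle_eq arccos_inner_eq_0_iff norm_dirvec)

lemma angle_rel_class:
  "\<gamma> \<in> Geod0 X \<Longrightarrow> angle_rel X `` {\<gamma>} = {\<eta> \<in> Geod0 X. dirvec L \<eta> = dirvec L \<gamma>}"
  by (auto simp: angle_rel_def angle_eq_0_iff)

text \<open>Rescaled to a small norm, \<open>V\<close> lies in \<open>bfV L\<close> and so generates
  a segment; the direction is unaffected.\<close>

lemma direction_attained:
  assumes "V \<in> calV L" "V \<noteq> 0"
  shows "\<exists>\<gamma>\<in>Geod0 X. dirvec L \<gamma> = sgn V"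
proof -
  obtain \<epsilon> where \<epsilon>: "\<epsilon> > 0" "\<And>V. V \<in> calV L \<Longrightarrow> norm V \<le> \<epsilon> \<Longrightarrow> V \<in> bfV L"
    using small_calV_mem_bfV[OF L] by blast
  define W where "W = \<epsilon> *\<^sub>R sgn V"
  have "W \<in> calV L"
    using assms by (simp add: W_def sgn_div_norm subspace_scale[OF subspace_calV])
  moreover have "norm W = \<epsilon>" "W \<noteq> 0"
    using assms \<epsilon>(1) by (simp_all add: W_def norm_sgn sgn_zero_iff)
  ultimately have "W \<in> bfV L - {0}" using \<epsilon>(2) by simp
  moreover have "sgn W = sgn V"
    using \<epsilon>(1) assms(2) by (simp add: W_def sgn_div_norm field_simps)
  ultimately show ?thesis using seg_mem_Geod0[OF LB] dirvec_seg by metis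
qed

text \<open>Regularity excludes L = 0, and \<open>L\<close> itself is a vector of
  \<open>calV L\<close>. A direction is needed to write the tip as a \<open>Tvec\<close> of radius
  0.\<close>

lemma Geod0_nonempty: "Geod0 X \<noteq> {}"
proof -
  have "L \<noteq> 0"
  proof
    assume "L = 0"
    then have "positive_definite (block (transpose L ** L) t t)" "block (transpose L ** L) t t = 0" for t
      using L linear_0[OF linear_block] by (simp_all add: BL_reg_def)
    then have "positive_definite (0 :: real^'d^'d)" by metis
    then have "axis i 1 \<bullet> (0 *v axis i 1 :: real^'d) > 0" for i :: 'd
      unfolding positive_definite_def by (metis axis_eq_0_iff zero_neq_one)
    then show False by simp
  qed
  then show ?thesis using direction_attained[OF self_mem_calV[OF LB]] by blast
qed

text \<open>Unambiguous on angle classes, because angle 0 means equal unit vectors.\<close>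

definition angle_dir :: "('t, 'd) curve set \<Rightarrow> ('t, 'd) bmat" where
  "angle_dir A = the_elem (dirvec L ` A)"

lemma angle_dir_class:
  assumes "\<gamma> \<in> Geod0 X"
  shows "angle_dir (angle_rel X `` {\<gamma>}) = dirvec L \<gamma>"
proof -
  have "dirvec L ` (angle_rel X `` {\<gamma>}) = {dirvec L \<gamma>}"
    using assms by (auto simp: angle_rel_class)
  then show ?thesis by (simp add: angle_dir_def)
qed

lemma Dirs_eq: "Dirs X = (\<lambda>\<gamma>. angle_rel X `` {\<gamma>}) ` Geod0 X"
  by (auto simp: Dirs_def quotient_def)

lemma angular_Dirs: "angular (Dirs X) (lift2 (angle X)) angle_dir"
proof
  show "inj_on angle_dir (Dirs X)"
  proof (rule inj_onI)
    fix A B assume "A \<in> Dirs X" "B \<in> Dirs X" and eq: "angle_dir A = angle_dir B"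
    then obtain \<gamma> \<eta> where "\<gamma> \<in> Geod0 X" "A = angle_rel X `` {\<gamma>}" "\<eta> \<in> Geod0 X" "B = angle_rel X `` {\<eta>}"
      unfolding Dirs_eq by blast
    with eq have "dirvec L \<gamma> = dirvec L \<eta>" by (simp only: angle_dir_class)
    then show "A = B" using \<open>\<gamma> \<in> Geod0 X\<close> \<open>\<eta> \<in> Geod0 X\<close>
      by (simp only: \<open>A = _\<close> \<open>B = _\<close> angle_rel_class)
  qed
  have "angle_dir ` Dirs X = dirvec L ` Geod0 X"
    unfolding Dirs_eq image_image by (rule image_cong) (simp_all add: angle_dir_class)
  \<comment> \<open>The directions of geodesics fill the whole unit sphere of \<open>calV L\<close>,
    whence closedness.\<close>
  also have "\<dots> = calV L \<inter> sphere 0 1"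
  proof (intro equalityI subsetI)
    fix v assume v: "v \<in> calV L \<inter> sphere 0 1"
    then have "norm v = 1" by simp
    then have "v \<noteq> 0" "sgn v = v" by (auto simp: sgn_div_norm)
    then show "v \<in> dirvec L ` Geod0 X" using direction_attained[of v] v by (metis IntD1 imageI)
  next
    fix v assume "v \<in> dirvec L ` Geod0 X"
    then obtain \<gamma> where "\<gamma> \<in> Geod0 X" "v = dirvec L \<gamma>" by blast
    then show "v \<in> calV L \<inter> sphere 0 1" by (simp add: norm_dirvec dirvec_mem_calV)
  qed
  finally show "closed (angle_dir ` Dirs X)"
    by (simp only: closed_Int closed_sphere closed_subspace[OF subspace_calV])
  show "norm (angle_dir A) = 1" if A: "A \<in> Dirs X" for A
  proof -
    obtain \<gamma> where "\<gamma> \<in> Geod0 X" "A = angle_rel X `` {\<gamma>}" using A unfolding Dirs_eq by blast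
    then show ?thesis by (simp only: angle_dir_class norm_dirvec)
  qed
  show "lift2 (angle X) A B = arccos (angle_dir A \<bullet> angle_dir B)" if AB: "A \<in> Dirs X" "B \<in> Dirs X" for A B
  proof -
    obtain \<gamma> \<eta> where A: "\<gamma> \<in> Geod0 X" "A = angle_rel X `` {\<gamma>}" and B: "\<eta> \<in> Geod0 X" "B = angle_rel X `` {\<eta>}"
      using AB unfolding Dirs_eq by blast
    show ?thesis
      unfolding A(2) B(2) angle_dir_class[OF A(1)] angle_dir_class[OF B(1)]
    proof (rule lift2_eqI)
      show "\<gamma> \<in> angle_rel X `` {\<gamma>}" "\<eta> \<in> angle_rel X `` {\<eta>}"
        using A B by (simp_all add: angle_rel_class)
      show "angle X x y = arccos (dirvec L \<gamma> \<bullet> dirvec L \<eta>)"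
        if "x \<in> angle_rel X `` {\<gamma>}" "y \<in> angle_rel X `` {\<eta>}" for x y
        using that A(1) B(1) by (simp add: angle_rel_class angle_eq)
    qed
  qed
qed

interpretation angular "Dirs X" "lift2 (angle X)" angle_dir
  by (rule angular_Dirs)

lemma class_mem_Dirs: "\<gamma> \<in> Geod0 X \<Longrightarrow> angle_rel X `` {\<gamma>} \<in> Dirs X"
  by (simp add: Dirs_eq)

lemma CDirs_eq: "CDirs X = dir_of X ` Geod0 X"
  unfolding CDirs_def completion_eq by (auto simp: Dirs_eq dir_of_def)

lemma CDirs_angle_dir_of:
  "\<gamma> \<in> Geod0 X \<Longrightarrow> \<eta> \<in> Geod0 X \<Longrightarrow>
    CDirs_angle X (dir_of X \<gamma>) (dir_of X \<eta>) = arccos (dirvec L \<gamma> \<bullet> dirvec L \<eta>)"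
  by (simp add: CDirs_angle_def dir_of_def completion_dist_embed class_mem_Dirs angle_dir_class)

lemma dir_of_cong:
  "\<gamma> \<in> Geod0 X \<Longrightarrow> \<eta> \<in> Geod0 X \<Longrightarrow> dirvec L \<gamma> = dirvec L \<eta> \<Longrightarrow> dir_of X \<gamma> = dir_of X \<eta>"
  by (simp add: dir_of_def angle_rel_class)

lemma Tvec_0: "\<gamma> \<in> Geod0 X \<Longrightarrow> Tvec X \<gamma> 0 = Ttip X"
  by (auto simp: Tvec_def cone_rel_def CDirs_eq Ttip_def)

lemma Tcone_eq: "Tcone X = (\<lambda>(\<gamma>, r). Tvec X \<gamma> r) ` (Geod0 X \<times> {0..})"
  by (auto simp: Tcone_def quotient_def Tvec_def CDirs_eq)

lemma TconeE:
  assumes "p \<in> Tcone X"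
  obtains \<gamma> r where "\<gamma> \<in> Geod0 X" "r \<ge> 0" "p = Tvec X \<gamma> r"
  using assms unfolding Tcone_eq by auto

text \<open>The cone metric is the law of cosines in \<open>calV L\<close>, since the cosine of the
  angle is the inner product of the unit vectors.\<close>

lemma Tdist_Tvec:
  assumes \<gamma>: "\<gamma> \<in> Geod0 X" and \<eta>: "\<eta> \<in> Geod0 X" and r: "r \<ge> 0" and s: "s \<ge> 0"
  shows "Tdist X (Tvec X \<gamma> r) (Tvec X \<eta> s) = norm (r *\<^sub>R dirvec L \<gamma> - s *\<^sub>R dirvec L \<eta>)"
proof -
  define f where "f = (\<lambda>(\<xi>, r) (\<zeta>, s). sqrt (r\<^sup>2 + s\<^sup>2 - 2 * r * s * cos (CDirs_angle X \<xi> \<zeta>)))"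
  define c where "c = norm (r *\<^sub>R dirvec L \<gamma> - s *\<^sub>R dirvec L \<eta>)"
  have c: "c = sqrt (r\<^sup>2 + s\<^sup>2 - 2 * r * s * (dirvec L \<gamma> \<bullet> dirvec L \<eta>))"
    using norm_dirvec[OF \<gamma>] norm_dirvec[OF \<eta>]
    by (simp add: c_def norm_eq_sqrt_inner inner_diff inner_commute power2_eq_square algebra_simps)
  have cos: "cos (CDirs_angle X (dir_of X \<gamma>) (dir_of X \<eta>)) = dirvec L \<gamma> \<bullet> dirvec L \<eta>"
    by (simp add: CDirs_angle_dir_of[OF \<gamma> \<eta>] cos_arccos_abs abs_inner_unit_le_1 norm_dirvec \<gamma> \<eta>)
  have "f p q = c" if pq: "p \<in> Tvec X \<gamma> r" "q \<in> Tvec X \<eta> s" for p q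
  proof -
    \<comment> \<open>At the tip a representative may carry any direction, but the cosine term is
      then multiplied by 0.\<close>
    have "p = (dir_of X \<gamma>, r) \<or> snd p = 0 \<and> r = 0" "q = (dir_of X \<eta>, s) \<or> snd q = 0 \<and> s = 0"
      using pq by (auto simp: Tvec_def cone_rel_def)
    then show ?thesis
      by (cases p; cases q) (auto simp: f_def c cos)
  qed
  moreover have "(dir_of X \<gamma>, r) \<in> Tvec X \<gamma> r" "(dir_of X \<eta>, s) \<in> Tvec X \<eta> s"
    using \<gamma> \<eta> r s by (auto simp: Tvec_def cone_rel_def CDirs_eq)
  ultimately have "lift2 f (Tvec X \<gamma> r) (Tvec X \<eta> s) = c" by (intro lift2_eqI)
  then show ?thesis by (simp add: Tdist_def f_def c_def)
qed

lemma Tvec_eq_iff: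
  assumes \<gamma>: "\<gamma> \<in> Geod0 X" and \<eta>: "\<eta> \<in> Geod0 X" and r: "r \<ge> 0" and s: "s \<ge> 0"
  shows "Tvec X \<gamma> r = Tvec X \<eta> s \<longleftrightarrow> r *\<^sub>R dirvec L \<gamma> = s *\<^sub>R dirvec L \<eta>"
proof
  assume "Tvec X \<gamma> r = Tvec X \<eta> s"
  then show "r *\<^sub>R dirvec L \<gamma> = s *\<^sub>R dirvec L \<eta>"
    using Tdist_Tvec[OF \<gamma> \<eta> r s] Tdist_Tvec[OF \<eta> \<eta> s s] by simp
next
  assume eq: "r *\<^sub>R dirvec L \<gamma> = s *\<^sub>R dirvec L \<eta>"
  then have "norm (r *\<^sub>R dirvec L \<gamma>) = norm (s *\<^sub>R dirvec L \<eta>)" by simp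
  then have rs: "r = s" using r s norm_dirvec[OF \<gamma>] norm_dirvec[OF \<eta>] by simp
  show "Tvec X \<gamma> r = Tvec X \<eta> s"
  proof (cases "s = 0")
    case True
    then show ?thesis using rs Tvec_0 \<gamma> \<eta> by simp
  next
    case False
    then have "dirvec L \<gamma> = dirvec L \<eta>" using eq rs by simp
    then show ?thesis using rs dir_of_cong[OF \<gamma> \<eta>] by (simp add: Tvec_def)
  qed
qed

lemma Ttip_eq_Tvec_iff: "\<gamma> \<in> Geod0 X \<Longrightarrow> r \<ge> 0 \<Longrightarrow> Tvec X \<gamma> r = Ttip X \<longleftrightarrow> r = 0"
  using Tvec_eq_iff[of \<gamma> \<gamma> r 0] Tvec_0[of \<gamma>] norm_dirvec[of \<gamma>] by auto

section \<open>The isometry and the exponential map\<close>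

text \<open>The definite description is resolved by constructing a map with all required properties.
  It is unique, because every tangent vector is some \<open>Tvec\<close>, where the value is
  prescribed.\<close>

lemma iota_bij: "bij_betw (iota L) (Tcone X) (calV L)"
  and iota_Tvec: "\<And>\<gamma> r. \<gamma> \<in> Geod0 X \<Longrightarrow> r \<ge> 0 \<Longrightarrow> iota L (Tvec X \<gamma> r) = r *\<^sub>R dirvec L \<gamma>"
proof -
  define Q where "Q = (\<lambda>f. f \<in> extensional (Tcone X) \<and> bij_betw f (Tcone X) (calV L) \<and>
     (\<forall>p\<in>Tcone X. \<forall>q\<in>Tcone X. norm (f p - f q) = Tdist X p q) \<and> f (Ttip X) = 0 \<and>
     (\<forall>\<gamma>\<in>Geod0 X. \<forall>r\<ge>0. f (Tvec X \<gamma> r) = (r / norm (geod_vec L \<gamma>)) *\<^sub>R geod_vec L \<gamma>))"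
  have scale: "(r / norm (geod_vec L \<gamma>)) *\<^sub>R geod_vec L \<gamma> = r *\<^sub>R dirvec L \<gamma>" for \<gamma> r
    by (simp add: dirvec_def sgn_div_norm divide_inverse)
  have Tvec_mem: "Tvec X \<gamma> r \<in> Tcone X" if "\<gamma> \<in> Geod0 X" "r \<ge> 0" for \<gamma> r
    using that by (auto simp: Tcone_eq)
  obtain \<gamma>0 where \<gamma>0: "\<gamma>0 \<in> Geod0 X" using Geod0_nonempty by blast
  \<comment> \<open>The set is a singleton for each \<open>p\<close> by \<open>Tvec_eq_iff\<close>,
    so no choice of \<gamma> and \<open>r\<close> matters.\<close>
  define f where "f = (\<lambda>p\<in>Tcone X. the_elem {r *\<^sub>R dirvec L \<gamma> | \<gamma> r. \<gamma> \<in> Geod0 X \<and> r \<ge> 0 \<and> p = Tvec X \<gamma> r})"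
  have f: "f (Tvec X \<gamma> r) = r *\<^sub>R dirvec L \<gamma>" if \<gamma>: "\<gamma> \<in> Geod0 X" and r: "r \<ge> 0" for \<gamma> r
  proof -
    have "{s *\<^sub>R dirvec L \<eta> | \<eta> s. \<eta> \<in> Geod0 X \<and> s \<ge> 0 \<and> Tvec X \<gamma> r = Tvec X \<eta> s} = {r *\<^sub>R dirvec L \<gamma>}"
    proof (intro equalityI subsetI)
      fix y assume "y \<in> {s *\<^sub>R dirvec L \<eta> | \<eta> s. \<eta> \<in> Geod0 X \<and> s \<ge> 0 \<and> Tvec X \<gamma> r = Tvec X \<eta> s}"
      then obtain \<eta> s where "y = s *\<^sub>R dirvec L \<eta>" "\<eta> \<in> Geod0 X" "s \<ge> 0" "Tvec X \<gamma> r = Tvec X \<eta> s"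
        by blast
      then show "y \<in> {r *\<^sub>R dirvec L \<gamma>}" using Tvec_eq_iff[OF \<gamma> _ r] by simp
    qed (use \<gamma> r in blast)
    then show ?thesis using Tvec_mem[OF \<gamma> r] by (simp add: f_def)
  qed
  have "bij_betw f (Tcone X) (calV L)"
    unfolding bij_betw_def
  proof (intro conjI equalityI subsetI)
    show "inj_on f (Tcone X)"
    proof (rule inj_onI)
      fix p q assume "p \<in> Tcone X" "q \<in> Tcone X" and eq: "f p = f q"
      then obtain \<gamma> r \<eta> s where \<gamma>: "\<gamma> \<in> Geod0 X" "r \<ge> 0" "p = Tvec X \<gamma> r"
        and \<eta>: "\<eta> \<in> Geod0 X" "s \<ge> 0" "q = Tvec X \<eta> s"
        by (meson TconeE)
      show "p = q"
        using eq unfolding \<gamma>(3) \<eta>(3) f[OF \<gamma>(1,2)] f[OF \<eta>(1,2)] Tvec_eq_iff[OF \<gamma>(1) \<eta>(1) \<gamma>(2) \<eta>(2)] .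
    qed
    show "V \<in> calV L" if "V \<in> f ` Tcone X" for V
    proof -
      obtain p where "V = f p" "p \<in> Tcone X" using \<open>V \<in> f ` Tcone X\<close> by blast
      then obtain \<gamma> r where "\<gamma> \<in> Geod0 X" "r \<ge> 0" "V = f (Tvec X \<gamma> r)" by (metis TconeE)
      then show ?thesis by (simp add: f subspace_scale[OF subspace_calV] dirvec_mem_calV)
    qed
    show "V \<in> f ` Tcone X" if V: "V \<in> calV L" for V
    proof (cases "V = 0")
      case True
      then have "f (Tvec X \<gamma>0 0) = V" using f[OF \<gamma>0] by simp
      then show ?thesis using Tvec_mem[OF \<gamma>0, of 0] by (metis imageI order_refl)
    next
      case False
      then obtain \<gamma> where \<gamma>: "\<gamma> \<in> Geod0 X" "dirvec L \<gamma> = sgn V" using direction_attained[OF V] by blast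
      then have "f (Tvec X \<gamma> (norm V)) = V" using f[OF \<gamma>(1)] by (simp add: sgn_div_norm False)
      then show ?thesis using Tvec_mem[OF \<gamma>(1), of "norm V"] by (metis imageI norm_ge_zero)
    qed
  qed
  moreover have "f (Ttip X) = 0" using f[OF \<gamma>0, of 0] Tvec_0[OF \<gamma>0] by simp
  moreover have "norm (f p - f q) = Tdist X p q" if "p \<in> Tcone X" "q \<in> Tcone X" for p q
    by (rule TconeE[OF \<open>p \<in> _\<close>]; rule TconeE[OF \<open>q \<in> _\<close>]) (simp add: f Tdist_Tvec)
  ultimately have "Q f" by (simp add: Q_def scale f) (simp add: f_def)
  moreover have "g = f" if "Q g" for g
  proof (rule extensionalityI[of _ "Tcone X"])
    show "g \<in> extensional (Tcone X)" "f \<in> extensional (Tcone X)" using that by (simp_all add: Q_def f_def)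
    show "g p = f p" if "p \<in> Tcone X" for p
      by (rule TconeE[OF \<open>p \<in> _\<close>]) (use \<open>Q g\<close> in \<open>simp add: Q_def scale f\<close>)
  qed
  ultimately have "iota L = f" unfolding iota_def Q_def[symmetric] by (rule the_equality)
  then show "bij_betw (iota L) (Tcone X) (calV L)"
    and "\<And>\<gamma> r. \<gamma> \<in> Geod0 X \<Longrightarrow> r \<ge> 0 \<Longrightarrow> iota L (Tvec X \<gamma> r) = r *\<^sub>R dirvec L \<gamma>"
    using \<open>Q f\<close> by (simp_all add: Q_def scale)
qed

lemma inv_iota:
  assumes \<gamma>: "\<gamma> \<in> Geod0 X" and r: "r \<ge> 0"
  shows "inv_into (Tcone X) (iota L) (r *\<^sub>R dirvec L \<gamma>) = Tvec X \<gamma> r"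
proof -
  have "Tvec X \<gamma> r \<in> Tcone X" unfolding Tcone_eq using \<gamma> r by force
  then show ?thesis
    using bij_betw_inv_into_left[OF iota_bij] iota_Tvec[OF \<gamma> r] by metis
qed

text \<open>The segment \<open>seg L V\<close> is itself an admissible geodesic. Any other one has
  the same direction and length, hence the same velocity vector, and so coincides with it.\<close>

lemma exp_map_inv_iota:
  assumes V: "V \<in> bfV L"
  shows "exp_map X (inv_into (Tcone X) (iota L) V) = Some (cls (L + V))"
proof (cases "V = 0")
  case True
  obtain \<gamma> where \<gamma>: "\<gamma> \<in> Geod0 X" using Geod0_nonempty by blast
  \<comment> \<open>The zero vector corresponds to radius 0 in any direction, which is the
    tip.\<close>
  then show ?thesis using inv_iota[OF \<gamma>, of 0] True by (simp add: Tvec_0 exp_map_def)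
next
  case False
  define \<gamma> where "\<gamma> = seg L V"
  have \<gamma>: "\<gamma> \<in> Geod0 X" and gv: "geod_vec L \<gamma> = V"
    unfolding \<gamma>_def using V False seg_mem_Geod0[OF LB, of V] geod_vec_seg[OF L, of V] by auto
  have \<gamma>1: "\<gamma> 1 = cls (L + V)" by (simp add: \<gamma>_def seg_def)
  define p where "p = Tvec X \<gamma> (norm V)"
  have p: "inv_into (Tcone X) (iota L) V = p"
    using inv_iota[OF \<gamma>, of "norm V"] geod_vec_eq_scaleR_dirvec[of \<gamma>] by (simp add: gv p_def)
  have tip: "p \<noteq> Ttip X" using Ttip_eq_Tvec_iff[OF \<gamma>, of "norm V"] False by (simp add: p_def)
  have reach: "exp_reaches X p (cls (L + V))"
    unfolding exp_reaches_def
  proof (intro bexI[of _ \<gamma>] exI[of _ "norm V"] conjI)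
    show "angle X \<gamma> \<gamma> = 0" using angle_eq_0_iff[OF \<gamma> \<gamma>] by simp
    show "dq X (\<gamma> 1) = norm V" using dq_endpoint[OF \<gamma>] gv by simp
  qed (use False \<gamma> \<gamma>1 in \<open>simp_all add: p_def\<close>)
  have unique: "Y = cls (L + V)" if Y: "exp_reaches X p Y" for Y
  proof -
    obtain \<gamma>' r \<eta> where \<gamma>': "\<gamma>' \<in> Geod0 X" "r > 0" "p = Tvec X \<gamma>' r"
      and \<eta>: "\<eta> \<in> Geod0 X" "angle X \<gamma>' \<eta> = 0" "dq X (\<eta> 1) = r" "Y = \<eta> 1"
      using Y unfolding exp_reaches_def by blast
    have "V = r *\<^sub>R dirvec L \<gamma>'"
      using \<gamma>' Tvec_eq_iff[OF \<gamma> \<gamma>'(1), of "norm V" r] geod_vec_eq_scaleR_dirvec[of \<gamma>]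
      by (simp add: p_def gv)
    also have "\<dots> = norm (geod_vec L \<eta>) *\<^sub>R dirvec L \<eta>"
      using \<eta> angle_eq_0_iff[OF \<gamma>'(1) \<eta>(1)] dq_endpoint[OF \<eta>(1)] by simp
    also have "\<dots> = geod_vec L \<eta>" by (rule geod_vec_eq_scaleR_dirvec[symmetric])
    finally have "\<eta> = \<gamma>" using seg_geod_vec(2)[OF \<eta>(1)] by (simp add: \<gamma>_def)
    then show ?thesis using \<eta>(4) \<gamma>1 by simp
  qed
  have "(THE Y. exp_reaches X p Y) = cls (L + V)"
    using reach unique by (rule the_equality)
  then show ?thesis using tip reach by (auto simp: exp_map_def p)
qed

end

theorem proposition1p8:
  fixes L V :: "('t::{finite,linorder}, 'd::finite) bmat"
  assumes "L \<in> BL_reg" and "V \<in> calV L"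
  shows "\<exists>r0>0. \<forall>r\<in>{0..r0}.
    exp_map (cls L) (inv_into (Tcone (cls L)) (iota L) (r *\<^sub>R V)) = Some (cls (L + r *\<^sub>R V))"
proof -
  interpret regular_point L by standard (rule assms(1))
  obtain \<epsilon> where \<epsilon>: "\<epsilon> > 0" "\<And>W. W \<in> calV L \<Longrightarrow> norm W \<le> \<epsilon> \<Longrightarrow> W \<in> bfV L"
    using small_calV_mem_bfV[OF assms(1)] by blast
  \<comment> \<open>Adding 1 keeps the denominator positive when V = 0.\<close>
  define r0 where "r0 = \<epsilon> / (norm V + 1)"
  have "r *\<^sub>R V \<in> bfV L" if r: "r \<in> {0..r0}" for r
  proof (rule \<epsilon>(2))
    show "r *\<^sub>R V \<in> calV L" by (rule subspace_scale[OF subspace_calV assms(2)])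
    have "r * norm V \<le> r * (norm V + 1)" using r by (intro mult_left_mono) auto
    also have "\<dots> \<le> r0 * (norm V + 1)" using r by (intro mult_right_mono) auto
    also have "\<dots> = \<epsilon>" using norm_ge_zero[of V] by (simp add: r0_def add_nonneg_eq_0_iff)
    finally show "norm (r *\<^sub>R V) \<le> \<epsilon>" using r by simp
  qed
  moreover have "r0 > 0" using \<epsilon>(1) norm_ge_zero[of V] by (simp add: r0_def add_nonneg_pos)
  ultimately show ?thesis using exp_map_inv_iota by blast
qed

end
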